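(* The monadic Grzegorczyk logic $\mathbf{MGrz}$ has the finite model property: for every formula $\varphi$ of $\mathcal{L}_\exists$ with $\mathbf{MGrz}\nvdash\varphi$, there is a finite $\mathbf{MGrz}$-frame in which $\varphi$ is not valid.
   Context: $\mathcal{L}_\exists$ is the propositional language with countably many propositional letters, connectives $\neg,\vee$ and two unary modalities $\Diamond$ and $\exists$; $\Box:=\neg\Diamond\neg$ and $\forall:=\neg\exists\neg$. $\mathbf{Grz}$ is the normal modal logic $\mathbf{S4}+\Box(\Box(p\to\Box p)\to p)\to p$. $\mathbf{MGrz}$ is the least set of $\mathcal{L}_\exists$-formulas containing all theorems of $\mathbf{Grz}$ (in $\Diamond$), the $\mathbf{S5}$ axioms for $\exists$, and the connecting axiom $\exists\Diamond p\to\Diamond\exists p$, and closed under modus ponens, $\Box$-necessitation, $\forall$-necessitation and uniform substitution. An $\mathbf{MK}$-frame is a triple $(X,R,E)$ with $X$ a nonempty set, $R$ a binary relation on $X$, $E$ an equivalence relation on $X$, such that for all $x,y,z\in X$: if $x\mathrel{E}y$ and $y\mathrel{R}z$ then there is $u$ with $x\mathrel{R}u$ and $u\mathrel{E}z$. Formulas are evaluated under a valuation (assignment of subsets of $X$ to letters) classically for Boolean connectives, with $x\models\Diamond\psi$ iff some $y$ with $x\mathrel{R}y$ satisfies $\psi$, and $x\models\exists\psi$ iff some $y$ with $x\mathrel{E}y$ satisfies $\psi$. A formula is valid in a frame if it holds at every point under every valuation. An $\mathbf{MGrz}$-frame is an $\mathbf{MK}$-frame in which every theorem of $\mathbf{MGrz}$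 is valid. *)

theory Defs
  imports Main
begin

datatype fm =
    Var nat
  | Neg fm
  | Or fm fm
  | Dia fm
  | Some_E fm

abbreviation Imp :: "fm \<Rightarrow> fm \<Rightarrow> fm" where
  "Imp a b \<equiv> Or (Neg a) b"

abbreviation Box :: "fm \<Rightarrow> fm" where
  "Box a \<equiv> Neg (Dia (Neg a))"

abbreviation All_E :: "fm \<Rightarrow> fm" where
  "All_E a \<equiv> Neg (Some_E (Neg a))"

primrec subst_fm :: "(nat \<Rightarrow> fm) \<Rightarrow> fm \<Rightarrow> fm" where
  "subst_fm s (Var n) = s n"
| "subst_fm s (Neg a) = Neg (subst_fm s a)"
| "subst_fm s (Or a b) = Or (subst_fm s a) (subst_fm s b)"
| "subst_fm s (Dia a) = Dia (subst_fm s a)"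
| "subst_fm s (Some_E a) = Some_E (subst_fm s a)"

text \<open>The formulas of the unimodal language of \<open>\<Diamond>\<close> are those without \<^const>\<open>Some_E\<close>.\<close>

primrec unimodal :: "fm \<Rightarrow> bool" where
  "unimodal (Var n) = True"
| "unimodal (Neg a) = unimodal a"
| "unimodal (Or a b) = (unimodal a \<and> unimodal b)"
| "unimodal (Dia a) = unimodal a"
| "unimodal (Some_E a) = False"

text \<open>Boolean evaluation in which letters and formulas starting with a modality are atoms.\<close>

primrec bool_eval :: "(fm \<Rightarrow> bool) \<Rightarrow> fm \<Rightarrow> bool" where
  "bool_eval g (Var n) = g (Var n)"
| "bool_eval g (Neg a) = (\<not> bool_eval g a)"
| "bool_eval g (Or a b) = (bool_eval g a \<or> bool_eval g b)"
| "bool_eval g (Dia a) = g (Dia a)"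
| "bool_eval g (Some_E a) = g (Some_E a)"

definition tautology :: "fm \<Rightarrow> bool" where
  "tautology a \<longleftrightarrow> (\<forall>g. bool_eval g a)"

text \<open>
  Since \<open>\<Diamond>\<close> and \<open>\<exists>\<close> are primitive and \<open>\<box>\<close>, \<open>\<forall>\<close> are abbreviations, normality of a
  modality is axiomatised by K together with the duality \<open>\<Diamond>p \<leftrightarrow> \<not>\<box>\<not>p\<close>; the latter does not
  follow from K and necessitation, because \<open>\<not>\<box>\<not>p\<close> is literally \<open>\<not>\<not>\<Diamond>\<not>\<not>p\<close>.
\<close>

inductive Grz :: "fm \<Rightarrow> bool" where
  Grz_taut: "unimodal a \<Longrightarrow> tautology a \<Longrightarrow> Grz a"
| Grz_K: "Grz (Imp (Box (Imp (Var 0) (Var 1))) (Imp (Box (Var 0)) (Box (Var 1))))"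
| Grz_dual1: "Grz (Imp (Dia (Var 0)) (Neg (Box (Neg (Var 0)))))"
| Grz_dual2: "Grz (Imp (Neg (Box (Neg (Var 0)))) (Dia (Var 0)))"
| Grz_T: "Grz (Imp (Box (Var 0)) (Var 0))"
| Grz_4: "Grz (Imp (Box (Var 0)) (Box (Box (Var 0))))"
| Grz_grz: "Grz (Imp (Box (Imp (Box (Imp (Var 0) (Box (Var 0)))) (Var 0))) (Var 0))"
| Grz_MP: "Grz (Imp a b) \<Longrightarrow> Grz a \<Longrightarrow> Grz b"
| Grz_nec: "Grz a \<Longrightarrow> Grz (Box a)"
| Grz_subst: "Grz a \<Longrightarrow> (\<And>n. unimodal (s n)) \<Longrightarrow> Grz (subst_fm s a)"

inductive MGrz :: "fm \<Rightarrow> bool" where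
  MGrz_Grz: "Grz a \<Longrightarrow> MGrz a"
| MGrz_K: "MGrz (Imp (All_E (Imp (Var 0) (Var 1))) (Imp (All_E (Var 0)) (All_E (Var 1))))"
| MGrz_dual1: "MGrz (Imp (Some_E (Var 0)) (Neg (All_E (Neg (Var 0)))))"
| MGrz_dual2: "MGrz (Imp (Neg (All_E (Neg (Var 0)))) (Some_E (Var 0)))"
| MGrz_T: "MGrz (Imp (All_E (Var 0)) (Var 0))"
| MGrz_4: "MGrz (Imp (All_E (Var 0)) (All_E (All_E (Var 0))))"
| MGrz_5: "MGrz (Imp (Some_E (Var 0)) (All_E (Some_E (Var 0))))"
| MGrz_conn: "MGrz (Imp (Some_E (Dia (Var 0))) (Dia (Some_E (Var 0))))"
| MGrz_MP: "MGrz (Imp a b) \<Longrightarrow> MGrz a \<Longrightarrow> MGrz b"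
| MGrz_nec_Box: "MGrz a \<Longrightarrow> MGrz (Box a)"
| MGrz_nec_All: "MGrz a \<Longrightarrow> MGrz (All_E a)"
| MGrz_subst: "MGrz a \<Longrightarrow> MGrz (subst_fm s a)"

definition MK_frame :: "'w set \<Rightarrow> ('w \<times> 'w) set \<Rightarrow> ('w \<times> 'w) set \<Rightarrow> bool" where
  "MK_frame X R E \<longleftrightarrow>
     X \<noteq> {} \<and> R \<subseteq> X \<times> X \<and> equiv X E \<and>
     (\<forall>x\<in>X. \<forall>y\<in>X. \<forall>z\<in>X.
        (x, y) \<in> E \<and> (y, z) \<in> R \<longrightarrow> (\<exists>u\<in>X. (x, u) \<in> R \<and> (u, z) \<in> E))"

primrec sat ::
  "('w \<times> 'w) set \<Rightarrow> ('w \<times> 'w) set \<Rightarrow> (nat \<Rightarrow> 'w set) \<Rightarrow> 'w \<Rightarrow> fm \<Rightarrow> bool" where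
  "sat R E V x (Var n) \<longleftrightarrow> x \<in> V n"
| "sat R E V x (Neg a) \<longleftrightarrow> \<not> sat R E V x a"
| "sat R E V x (Or a b) \<longleftrightarrow> sat R E V x a \<or> sat R E V x b"
| "sat R E V x (Dia a) \<longleftrightarrow> (\<exists>y. (x, y) \<in> R \<and> sat R E V y a)"
| "sat R E V x (Some_E a) \<longleftrightarrow> (\<exists>y. (x, y) \<in> E \<and> sat R E V y a)"

definition valid_in ::
  "'w set \<Rightarrow> ('w \<times> 'w) set \<Rightarrow> ('w \<times> 'w) set \<Rightarrow> fm \<Rightarrow> bool" where
  "valid_in X R E a \<longleftrightarrow> (\<forall>V. (\<forall>n. V n \<subseteq> X) \<longrightarrow> (\<forall>x\<in>X. sat R E V x a))"

definition MGrz_frame :: "'w set \<Rightarrow> ('w \<times> 'w) set \<Rightarrow> ('w \<times> 'w) set \<Rightarrow> bool" where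
  "MGrz_frame X R E \<longleftrightarrow> MK_frame X R E \<and> (\<forall>a. MGrz a \<longrightarrow> valid_in X R E a)"

end

theory Submission
  imports Defs "HOL-Library.Countable"
begin

text \<open>
  Let \<open>\<Sigma>\<close> be the set of subformulas of \<open>\<phi>\<close>. In the canonical model of \<open>MGrz\<close> give a point \<open>x\<close> its
  \<open>\<Sigma>\<close>-type, the class type consisting of the \<open>\<Sigma>\<close>-types occurring in its \<open>E\<close>-class, and the set of
  class types of its \<open>R\<close>-successors; the last two are invariant under \<open>E\<close>, all three take finitely
  many values, and points and classes of a given type are definable by formulas. Every class type is
  realized by a finite partially ordered model. Otherwise choose a point \<open>x\<close> whose class type \<open>T\<close> is not
  realized and which sees as few class types as possible. The Grzegorczyk axiom, applied to the formula
  defining \<open>T\<close>, lets us assume that \<open>T\<close> is never seen again once it has been left, and then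
  minimality makes every other class type seen from \<open>x\<close> realizable. A finite model of \<open>T\<close> arises by
  placing one new \<open>E\<close>-class below finite models of these class types: its elements are finitely many
  points of class type \<open>T\<close>, each chosen by the Grzegorczyk axiom so that it does not see its own type
  again after leaving it. The new class may be linked to any element of the right type in the class it
  sees, because a model of a class type contains all the required types in a single \<open>E\<close>-class.
\<close>

section \<open>Soundness for finite partial orders\<close>

text \<open>Serves both ends of the proof: the canonical frame is of this kind, and a finite frame
  of this kind with antisymmetric \<open>R\<close> is an \<open>MGrz_frame\<close> by
  \<open>MGrz_sound\<close>.\<close>

definition MS4_frame :: "'w set \<Rightarrow> ('w \<times> 'w) set \<Rightarrow> ('w \<times> 'w) set \<Rightarrow> bool" where
  "MS4_frame X R E \<longleftrightarrow> MK_frame X R E \<and> (\<forall>x\<in>X. (x, x) \<in> R) \<and> trans R"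

lemma MS4_frameD:
  assumes "MS4_frame X R E"
  shows "X \<noteq> {}" "(x, y) \<in> R \<Longrightarrow> x \<in> X \<and> y \<in> X" "(x, y) \<in> E \<Longrightarrow> x \<in> X \<and> y \<in> X"
    "x \<in> X \<Longrightarrow> (x, x) \<in> R" "x \<in> X \<Longrightarrow> (x, x) \<in> E"
    "(x, y) \<in> E \<Longrightarrow> (y, x) \<in> E"
    "(x, y) \<in> R \<Longrightarrow> (y, z) \<in> R \<Longrightarrow> (x, z) \<in> R"
    "(x, y) \<in> E \<Longrightarrow> (y, z) \<in> E \<Longrightarrow> (x, z) \<in> E"
    "(x, y) \<in> E \<Longrightarrow> (y, z) \<in> R \<Longrightarrow> \<exists>u. (x, u) \<in> R \<and> (u, z) \<in> E"
proof -
  have *: "X \<noteq> {}" "R \<subseteq> X \<times> X" "E \<subseteq> X \<times> X" "refl_on X E" "sym E" "trans E" "trans R"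
    "\<forall>x\<in>X. (x, x) \<in> R"
    and comm: "\<forall>x\<in>X. \<forall>y\<in>X. \<forall>z\<in>X. (x, y) \<in> E \<and> (y, z) \<in> R \<longrightarrow> (\<exists>u\<in>X. (x, u) \<in> R \<and> (u, z) \<in> E)"
    using assms by (simp_all add: MS4_frame_def MK_frame_def equiv_def)
  show "X \<noteq> {}" "(x, y) \<in> R \<Longrightarrow> x \<in> X \<and> y \<in> X" "(x, y) \<in> E \<Longrightarrow> x \<in> X \<and> y \<in> X"
    "x \<in> X \<Longrightarrow> (x, x) \<in> R" "x \<in> X \<Longrightarrow> (x, x) \<in> E" "(x, y) \<in> E \<Longrightarrow> (y, x) \<in> E"
    "(x, y) \<in> R \<Longrightarrow> (y, z) \<in> R \<Longrightarrow> (x, z) \<in> R"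
    "(x, y) \<in> E \<Longrightarrow> (y, z) \<in> E \<Longrightarrow> (x, z) \<in> E"
    using * by (auto dest: symD transD refl_onD)
  show "\<exists>u. (x, u) \<in> R \<and> (u, z) \<in> E" if "(x, y) \<in> E" "(y, z) \<in> R"
  proof -
    have "x \<in> X" "y \<in> X" "z \<in> X"
      using that *(2,3) by auto
    then show ?thesis using comm that by blast
  qed
qed

lemma MS4_frameI:
  assumes "X \<noteq> {}" "R \<subseteq> X \<times> X" "E \<subseteq> X \<times> X"
    and "\<And>x. x \<in> X \<Longrightarrow> (x, x) \<in> R" "\<And>x. x \<in> X \<Longrightarrow> (x, x) \<in> E"
    and "\<And>x y. (x, y) \<in> E \<Longrightarrow> (y, x) \<in> E"
    and "\<And>x y z. (x, y) \<in> R \<Longrightarrow> (y, z) \<in> R \<Longrightarrow> (x, z) \<in> R"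
    and "\<And>x y z. (x, y) \<in> E \<Longrightarrow> (y, z) \<in> E \<Longrightarrow> (x, z) \<in> E"
    and "\<And>x y z. (x, y) \<in> E \<Longrightarrow> (y, z) \<in> R \<Longrightarrow> \<exists>u. (x, u) \<in> R \<and> (u, z) \<in> E"
  shows "MS4_frame X R E"
proof -
  have "refl_on X E"
    using assms(5) by (rule refl_onI)
  moreover have "sym E"
    using assms(6) by (rule symI)
  moreover have "trans E"
    using assms(8) by (rule transI)
  moreover have "trans R"
    using assms(7) by (rule transI)
  moreover have "\<exists>u\<in>X. (x, u) \<in> R \<and> (u, z) \<in> E" if "(x, y) \<in> E" "(y, z) \<in> R" for x y z
    using assms(9)[OF that] assms(2) by auto
  ultimately show ?thesis
    unfolding MS4_frame_def MK_frame_def equiv_def using assms(1-4) by auto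
qed

text \<open>Truth at a fixed point is one of the atom assignments quantified over in
  \<open>tautology\<close>, which settles the tautology case of soundness.\<close>

lemma sat_bool_eval: "sat R E V x a = bool_eval (sat R E V x) a"
  by (induction a) auto

text \<open>Cutting the new valuation down to \<open>X\<close> makes it admissible for
  \<open>valid_in\<close>; evaluation never leaves \<open>X\<close>, because both relations stay
  inside it.\<close>

lemma sat_subst:
  assumes "R \<subseteq> X \<times> X" "E \<subseteq> X \<times> X" "x \<in> X"
  shows "sat R E V x (subst_fm s a) = sat R E (\<lambda>n. {y \<in> X. sat R E V y (s n)}) x a"
  using assms(3)
proof (induction a arbitrary: x)
  case (Dia a)
  then show ?case using assms(1) by auto
next
  case (Some_E a)
  then show ?case using assms(2) by auto
qed auto

lemma valid_in_subst:
  assumes "MK_frame X R E" "valid_in X R E a"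
  shows "valid_in X R E (subst_fm s a)"
proof -
  have "R \<subseteq> X \<times> X" "E \<subseteq> X \<times> X"
    using assms(1) by (auto simp: MK_frame_def equiv_def)
  then show ?thesis
    using assms(2) unfolding valid_in_def by (auto simp: sat_subst)
qed

lemma finite_ex_maximal:
  assumes "finite X" "R \<subseteq> X \<times> X" "trans R" "antisym R" "\<forall>x\<in>X. (x, x) \<in> R" "A \<subseteq> X" "a \<in> A"
  shows "\<exists>y\<in>A. (a, y) \<in> R \<and> (\<forall>z\<in>A. (y, z) \<in> R \<longrightarrow> z = y)"
proof -
  \<comment> \<open>Among the elements of \<open>A\<close> above \<open>a\<close>, take one with
    fewest \<open>R\<close>-successors: a step to a different point of \<open>A\<close> would
    strictly lose successors, by antisymmetry.\<close>
  have "\<exists>y. (y \<in> A \<and> (a, y) \<in> R) \<and> (\<forall>z. z \<in> A \<and> (a, z) \<in> R \<longrightarrow> card (R `` {y}) \<le> card (R `` {z}))"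
    by (rule ex_has_least_nat[of _ a]) (use assms in blast)
  then obtain y where y: "y \<in> A" "(a, y) \<in> R"
    and min: "\<And>z. z \<in> A \<Longrightarrow> (a, z) \<in> R \<Longrightarrow> card (R `` {y}) \<le> card (R `` {z})"
    by blast
  have "z = y" if z: "z \<in> A" "(y, z) \<in> R" for z
  proof -
    have sub: "R `` {z} \<subseteq> R `` {y}"
      using z(2) assms(3) by (auto dest: transD)
    have "finite (R `` {y})"
      using assms(1,2) by (auto intro: finite_subset[of _ X])
    moreover have "card (R `` {y}) \<le> card (R `` {z})"
      using min z y(2) assms(3) by (blast dest: transD)
    ultimately have "R `` {z} = R `` {y}"
      using sub by (simp add: card_subset_eq card_mono le_antisym)
    then have "(z, y) \<in> R"
      using y(1) assms(5,6) by blast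
    then show ?thesis
      using z(2) assms(4) by (auto dest: antisymD)
  qed
  then show ?thesis using y by blast
qed

text \<open>If \<open>Var 0\<close> fails at \<open>x\<close>, let \<open>y\<close> be a maximal
  failing point above \<open>x\<close>. Nothing strictly above \<open>y\<close> fails
  \<open>Var 0\<close>, so \<open>y\<close> satisfies the inner box but not \<open>Var 0\<close>,
  and the antecedent fails at \<open>x\<close>.\<close>

lemma grz_axiom_valid:
  assumes "finite X" "MS4_frame X R E" "antisym R"
  shows "valid_in X R E (Imp (Box (Imp (Box (Imp (Var 0) (Box (Var 0)))) (Var 0))) (Var 0))"
  unfolding valid_in_def
proof (intro allI impI ballI)
  fix V :: "nat \<Rightarrow> 'a set" and x
  assume "x \<in> X"
  note F = MS4_frameD[OF assms(2)]
  show "sat R E V x (Imp (Box (Imp (Box (Imp (Var 0) (Box (Var 0)))) (Var 0))) (Var 0))"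
  proof (rule ccontr)
    assume neg: "\<not> ?thesis"
    then have "x \<in> X - V 0"
      using \<open>x \<in> X\<close> by simp
    moreover have "R \<subseteq> X \<times> X" "trans R" "\<forall>x\<in>X. (x, x) \<in> R"
      using assms(2) by (auto simp: MS4_frame_def MK_frame_def)
    ultimately obtain y where y: "y \<in> X - V 0" "(x, y) \<in> R" "\<And>z. z \<in> X - V 0 \<Longrightarrow> (y, z) \<in> R \<Longrightarrow> z = y"
      using finite_ex_maximal[OF assms(1) _ _ assms(3)] by (metis Diff_subset)
    have "w \<in> V 0" if "(y, z) \<in> R" "z \<in> V 0" "(z, w) \<in> R" for z w
    proof (rule ccontr)
      assume "w \<notin> V 0"
      then have "w = y"
        using y(3) F(2,7) that by blast
      then have "z = y"
        using that assms(3) by (auto dest: antisymD)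
      then show False using that y(1) by blast
    qed
    then show False using neg y(1,2) by auto
  qed
qed

lemma MGrz_sound:
  assumes "finite X" "MS4_frame X R E" "antisym R"
  shows "MGrz_frame X R E"
proof -
  have MK: "MK_frame X R E"
    using assms(2) by (simp add: MS4_frame_def)
  note F = MS4_frameD[OF assms(2)]
  have mp: "valid_in X R E b" if "valid_in X R E (Imp a b)" "valid_in X R E a" for a b
    using that by (auto simp: valid_in_def)
  have nec: "valid_in X R E (Box a) \<and> valid_in X R E (All_E a)" if "valid_in X R E a" for a
    using that F(2,3) by (auto simp: valid_in_def)
  have Grz: "valid_in X R E a" if "Grz a" for a
    using that
  proof induction
    case (Grz_taut a)
    then show ?case by (simp add: valid_in_def tautology_def sat_bool_eval)
  next
    case Grz_T
    then show ?case using F(4) by (auto simp: valid_in_def)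
  next
    case Grz_4
    then show ?case using F(7) by (auto simp: valid_in_def)
  next
    case Grz_grz
    then show ?case by (rule grz_axiom_valid[OF assms])
  next
    case (Grz_MP a b)
    then show ?case using mp by blast
  next
    case (Grz_nec a)
    then show ?case using nec by blast
  next
    case (Grz_subst a s)
    then show ?case using valid_in_subst[OF MK] by blast
  qed (auto simp: valid_in_def)
  have "valid_in X R E a" if "MGrz a" for a
    using that
  proof induction
    case (MGrz_Grz a)
    then show ?case by (rule Grz)
  next
    case MGrz_T
    then show ?case using F(5) by (auto simp: valid_in_def)
  next
    case MGrz_4
    have "sat R E V x (Some_E (Neg (Var 0)))" if "(x, y) \<in> E" "sat R E V y (Some_E (Neg (Var 0)))" for V x y
      using that F(8) by (metis sat.simps(5))
    then show ?case by (simp add: valid_in_def) metis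
  next
    case MGrz_5
    have "(y, z) \<in> E" if "(x, y) \<in> E" "(x, z) \<in> E" for x y z
      using that F(6,8) by blast
    then have "sat R E V y (Some_E (Var 0))" if "(x, y) \<in> E" "sat R E V x (Some_E (Var 0))" for V x y
      using that by (metis sat.simps(5))
    then show ?case by (simp add: valid_in_def) metis
  next
    case MGrz_conn
    have "sat R E V x (Dia (Some_E (Var 0)))" if "sat R E V x (Some_E (Dia (Var 0)))" for V x
    proof -
      obtain y z where "(x, y) \<in> E" "(y, z) \<in> R" "z \<in> V 0"
        using \<open>sat R E V x (Some_E (Dia (Var 0)))\<close> by auto
      then show ?thesis using F(9)[of x y z] by auto
    qed
    then show ?case unfolding valid_in_def sat.simps(2,3) by blast
  next
    case (MGrz_MP a b)
    then show ?case using mp by blast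
  next
    case (MGrz_nec_Box a)
    then show ?case using nec by blast
  next
    case (MGrz_nec_All a)
    then show ?case using nec by blast
  next
    case (MGrz_subst a s)
    then show ?case using valid_in_subst[OF MK] by blast
  qed (auto simp: valid_in_def)
  then show ?thesis using MK by (simp add: MGrz_frame_def)
qed

section \<open>The canonical model\<close>

instance fm :: countable
  by countable_datatype

text \<open>
  \<open>Grz\<close> contains only the unimodal tautologies; coding modal subformulas as letters exhibits every
  tautology as a substitution instance of one of them.
\<close>

primrec flat :: "fm \<Rightarrow> fm" where
  "flat (Var n) = Var (to_nat (Var n))"
| "flat (Neg a) = Neg (flat a)"
| "flat (Or a b) = Or (flat a) (flat b)"
| "flat (Dia a) = Var (to_nat (Dia a))"
| "flat (Some_E a) = Var (to_nat (Some_E a))"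

lemma unimodal_flat: "unimodal (flat a)"
  by (induction a) auto

lemma subst_flat: "subst_fm from_nat (flat a) = a"
  by (induction a) auto

lemma bool_eval_flat: "bool_eval g (flat a) = bool_eval (\<lambda>b. g (Var (to_nat b))) a"
  by (induction a) auto

lemma MGrz_taut:
  assumes "tautology a"
  shows "MGrz a"
proof -
  have "tautology (flat a)"
    using assms by (simp add: tautology_def bool_eval_flat)
  then have "MGrz (flat a)"
    by (intro MGrz_Grz Grz_taut unimodal_flat)
  then show ?thesis
    using MGrz_subst subst_flat by metis
qed

section \<open>Propositional reasoning and maximal consistent sets\<close>

abbreviation imps :: "fm list \<Rightarrow> fm \<Rightarrow> fm" where
  "imps L a \<equiv> foldr Imp L a"

lemma bool_eval_imps: "bool_eval g (imps L a) \<longleftrightarrow> ((\<forall>b\<in>set L. bool_eval g b) \<longrightarrow> bool_eval g a)"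
  by (induction L) auto

lemma MGrz_imps_MP:
  assumes "MGrz (imps L a)" "\<forall>b\<in>set L. MGrz b"
  shows "MGrz a"
  using assms by (induction L) (auto intro: MGrz_MP)

text \<open>Reduces every propositional step in the calculus to a check on Boolean evaluations;
  \<open>L\<close> lists the theorems on which the step relies.\<close>

lemma MGrz_cons:
  assumes "\<forall>b\<in>set L. MGrz b"
    and "\<And>g. (\<forall>b\<in>set L. bool_eval g b) \<Longrightarrow> bool_eval g a"
  shows "MGrz a"
proof -
  have "MGrz (imps L a)"
    using assms(2) by (intro MGrz_taut) (auto simp: tautology_def bool_eval_imps)
  then show ?thesis using assms(1) by (rule MGrz_imps_MP)
qed

abbreviation Bot :: fm where
  "Bot \<equiv> Neg (Or (Var 0) (Neg (Var 0)))"

definition derives :: "fm set \<Rightarrow> fm \<Rightarrow> bool" where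
  "derives \<Gamma> a \<longleftrightarrow> (\<exists>L. set L \<subseteq> \<Gamma> \<and> MGrz (imps L a))"

lemma derives_cons:
  assumes "\<forall>b\<in>set B. derives \<Gamma> b"
    and "\<And>g. (\<forall>b\<in>set B. bool_eval g b) \<Longrightarrow> bool_eval g a"
  shows "derives \<Gamma> a"
proof -
  obtain f where f: "\<forall>b\<in>set B. set (f b) \<subseteq> \<Gamma> \<and> MGrz (imps (f b) b)"
    using assms(1) unfolding derives_def by metis
  let ?L = "concat (map f B)"
  have "MGrz (imps ?L a)"
    by (rule MGrz_cons[of "map (\<lambda>b. imps (f b) b) B"]) (use f assms(2) in \<open>auto simp: bool_eval_imps\<close>)
  moreover have "set ?L \<subseteq> \<Gamma>"
    using f by auto
  ultimately show ?thesis
    unfolding derives_def by blast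
qed

lemma derives_member: "a \<in> \<Gamma> \<Longrightarrow> derives \<Gamma> a"
  unfolding derives_def by (intro exI[of _ "[a]"]) (auto intro!: MGrz_taut simp: tautology_def)

lemma derives_theorem: "MGrz a \<Longrightarrow> derives \<Gamma> a"
  unfolding derives_def by (intro exI[of _ "[]"]) auto

text \<open>Deduction theorem. The premise \<open>b\<close> may occur several times in the list;
  \<open>removeAll\<close> drops all occurrences at once, and a single antecedent replaces them
  propositionally.\<close>

lemma derives_insert: "derives (insert b \<Gamma>) a \<Longrightarrow> derives \<Gamma> (Imp b a)"
proof -
  assume "derives (insert b \<Gamma>) a"
  then obtain L where L: "set L \<subseteq> insert b \<Gamma>" "MGrz (imps L a)"
    unfolding derives_def by blast
  have "MGrz (imps (removeAll b L) (Imp b a))"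
    by (rule MGrz_cons[of "[imps L a]"]) (use L(2) in \<open>auto simp: bool_eval_imps\<close>)
  then show ?thesis
    using L(1) unfolding derives_def by (intro exI[of _ "removeAll b L"]) auto
qed

text \<open>Maximal consistent sets, described by how they commute with the connectives. Consistency
  is in the clause for \<open>Neg\<close>; closure under modus ponens follows from the clauses for
  \<open>Or\<close> and \<open>Neg\<close>.\<close>

definition world :: "fm set \<Rightarrow> bool" where
  "world \<Gamma> \<longleftrightarrow> (\<forall>a. MGrz a \<longrightarrow> a \<in> \<Gamma>) \<and> (\<forall>a. Neg a \<in> \<Gamma> \<longleftrightarrow> a \<notin> \<Gamma>)
     \<and> (\<forall>a b. Or a b \<in> \<Gamma> \<longleftrightarrow> a \<in> \<Gamma> \<or> b \<in> \<Gamma>)"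

lemma world_simps:
  assumes "world \<Gamma>"
  shows "MGrz a \<Longrightarrow> a \<in> \<Gamma>" "Neg a \<in> \<Gamma> \<longleftrightarrow> a \<notin> \<Gamma>" "Or a b \<in> \<Gamma> \<longleftrightarrow> a \<in> \<Gamma> \<or> b \<in> \<Gamma>"
  using assms by (auto simp: world_def)

lemma world_MP: "world \<Gamma> \<Longrightarrow> MGrz (Imp a b) \<Longrightarrow> a \<in> \<Gamma> \<Longrightarrow> b \<in> \<Gamma>"
  using world_simps by blast

lemma world_imps: "world \<Gamma> \<Longrightarrow> imps L a \<in> \<Gamma> \<longleftrightarrow> (set L \<subseteq> \<Gamma> \<longrightarrow> a \<in> \<Gamma>)"
  by (induction L) (auto simp: world_simps)

text \<open>Lindenbaum's lemma by Zorn: a derivation uses finitely many premises, so consistency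
  passes to unions of nonempty chains. Maximality gives deductive closure, and from it the clauses
  for the connectives.\<close>

lemma world_extension:
  assumes "\<not> derives \<Gamma> Bot"
  shows "\<exists>\<Delta>. world \<Delta> \<and> \<Gamma> \<subseteq> \<Delta>"
proof -
  let ?A = "{\<Delta>. \<Gamma> \<subseteq> \<Delta> \<and> \<not> derives \<Delta> Bot}"
  have "\<exists>M\<in>?A. \<forall>X\<in>?A. M \<subseteq> X \<longrightarrow> X = M"
  proof (rule subset_Zorn_nonempty)
    show "?A \<noteq> {}" using assms by blast
  next
    fix C
    assume C: "C \<noteq> {}" "subset.chain ?A C"
    have "\<not> derives (\<Union>C) Bot"
    proof
      assume "derives (\<Union>C) Bot"
      then obtain L where L: "set L \<subseteq> \<Union>C" "MGrz (imps L Bot)"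
        unfolding derives_def by blast
      obtain \<Delta> where "\<Delta> \<in> C" "set L \<subseteq> \<Delta>"
        using finite_subset_Union_chain[OF _ L(1) C(1) C(2)] by blast
      then show False
        using C(2) L(2) unfolding derives_def subset_chain_def by blast
    qed
    then show "\<Union>C \<in> ?A"
      using C unfolding subset_chain_def by blast
  qed
  then obtain \<Delta> where \<Delta>: "\<Gamma> \<subseteq> \<Delta>" "\<not> derives \<Delta> Bot"
    and max_A: "\<forall>X\<in>?A. \<Delta> \<subseteq> X \<longrightarrow> X = \<Delta>"
    by blast
  have max: "X = \<Delta>" if "\<Delta> \<subseteq> X" "\<not> derives X Bot" for X
    using max_A that \<Delta>(1) by simp
  have closed: "a \<in> \<Delta> \<longleftrightarrow> derives \<Delta> a" for a
  proof
    assume a: "derives \<Delta> a"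
    have "\<not> derives (insert a \<Delta>) Bot"
    proof
      assume "derives (insert a \<Delta>) Bot"
      then have "derives \<Delta> (Imp a Bot)"
        by (rule derives_insert)
      with a have "derives \<Delta> Bot"
        using derives_cons[of "[a, Imp a Bot]" \<Delta> Bot] by auto
      with \<Delta>(2) show False ..
    qed
    then show "a \<in> \<Delta>" using max by blast
  qed (rule derives_member)
  have neg: "Neg a \<in> \<Delta> \<longleftrightarrow> a \<notin> \<Delta>" for a
  proof
    assume "Neg a \<in> \<Delta>"
    then show "a \<notin> \<Delta>"
      using \<Delta>(2) derives_cons[of "[a, Neg a]" \<Delta> Bot] by (auto simp: closed)
  next
    assume "a \<notin> \<Delta>"
    then have "derives (insert a \<Delta>) Bot"
      using max by blast
    then have "derives \<Delta> (Imp a Bot)"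
      by (rule derives_insert)
    then show "Neg a \<in> \<Delta>"
      using derives_cons[of "[Imp a Bot]" \<Delta> "Neg a"] by (auto simp: closed)
  qed
  have disj: "Or a b \<in> \<Delta> \<longleftrightarrow> a \<in> \<Delta> \<or> b \<in> \<Delta>" for a b
  proof
    assume "Or a b \<in> \<Delta>"
    show "a \<in> \<Delta> \<or> b \<in> \<Delta>"
    proof (rule ccontr)
      assume "\<not> ?thesis"
      then have "derives \<Delta> Bot"
        using \<open>Or a b \<in> \<Delta>\<close> neg[of a] neg[of b] derives_cons[of "[Or a b, Neg a, Neg b]" \<Delta> Bot]
        by (auto simp: closed)
      with \<Delta>(2) show False ..
    qed
  next
    assume "a \<in> \<Delta> \<or> b \<in> \<Delta>"
    then show "Or a b \<in> \<Delta>"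
      using derives_cons[of "[a]" \<Delta> "Or a b"] derives_cons[of "[b]" \<Delta> "Or a b"]
      by (auto simp: closed)
  qed
  have "a \<in> \<Delta>" if "MGrz a" for a
    using that by (simp add: closed derives_theorem)
  then have "world \<Delta>"
    unfolding world_def using neg disj by simp
  then show ?thesis using \<Delta>(1) by blast
qed

subsection \<open>Normal diamonds\<close>

text \<open>Normality and S4 for a single modality, to be shared by \<open>Dia\<close> and
  \<open>Some_E\<close>, with the box spelled out as \<open>Neg (M (Neg a))\<close>. Axiom 5 enters
  separately in \<open>E_sym\<close>.\<close>

locale diamond =
  fixes M :: "fm \<Rightarrow> fm"
  assumes K: "MGrz (Imp (Neg (M (Neg (Imp a b)))) (Imp (Neg (M (Neg a))) (Neg (M (Neg b)))))"
    and dual1: "MGrz (Imp (M a) (Neg (Neg (M (Neg (Neg a))))))"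
    and dual2: "MGrz (Imp (Neg (Neg (M (Neg (Neg a))))) (M a))"
    and nec: "MGrz a \<Longrightarrow> MGrz (Neg (M (Neg a)))"
    and T: "MGrz (Imp (Neg (M (Neg a))) a)"
    and four: "MGrz (Imp (Neg (M (Neg a))) (Neg (M (Neg (Neg (M (Neg a)))))))"
begin

text \<open>For worlds this is the usual condition that \<open>\<Delta>\<close> contains every
  formula whose box lies in \<open>\<Gamma>\<close>, phrased through the primitive diamond.\<close>

definition rel :: "(fm set \<times> fm set) set" where
  "rel = {(\<Gamma>, \<Delta>). world \<Gamma> \<and> world \<Delta> \<and> (\<forall>a\<in>\<Delta>. M a \<in> \<Gamma>)}"

text \<open>The box is an abbreviation, so instances of K, T and 4 at negated formulas leave double
  negations under \<open>M\<close>; duality removes them.\<close>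

lemma double_neg:
  assumes "world \<Gamma>"
  shows "M (Neg (Neg a)) \<in> \<Gamma> \<longleftrightarrow> M a \<in> \<Gamma>"
  using world_MP[OF assms dual1[of a]] world_MP[OF assms dual2[of a]]
  by (auto simp: world_simps[OF assms])

lemma mono_theorem:
  assumes "MGrz (Imp a b)"
  shows "MGrz (Imp (M a) (M b))"
proof -
  let ?c = "Imp (Neg b) (Neg a)"
  have "MGrz ?c"
    by (rule MGrz_cons[of "[Imp a b]"]) (use assms in auto)
  then have "MGrz (Neg (M (Neg ?c)))"
    by (rule nec)
  then show ?thesis
    using K[of "Neg b" "Neg a"] dual1[of a] dual2[of b]
      MGrz_cons[of "[Neg (M (Neg ?c)),
        Imp (Neg (M (Neg ?c))) (Imp (Neg (M (Neg (Neg b)))) (Neg (M (Neg (Neg a))))),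
        Imp (M a) (Neg (Neg (M (Neg (Neg a))))), Imp (Neg (Neg (M (Neg (Neg b))))) (M b)]"
        "Imp (M a) (M b)"]
    by auto
qed

lemma mono: "world \<Gamma> \<Longrightarrow> MGrz (Imp a b) \<Longrightarrow> M a \<in> \<Gamma> \<Longrightarrow> M b \<in> \<Gamma>"
  using mono_theorem world_MP by blast

text \<open>If neither disjunct is possible, both negations are boxed; two uses of K on the boxed
  tautology that they jointly imply the negated disjunction then refute
  \<open>M (Or a b)\<close>.\<close>

lemma additive:
  assumes "world \<Gamma>" "M (Or a b) \<in> \<Gamma>"
  shows "M a \<in> \<Gamma> \<or> M b \<in> \<Gamma>"
proof -
  let ?c = "Imp (Neg b) (Neg (Or a b))"
  have "MGrz (Imp (Neg a) ?c)"
    by (rule MGrz_taut) (auto simp: tautology_def)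
  then have "Neg (M (Neg (Imp (Neg a) ?c))) \<in> \<Gamma>"
    using nec world_simps(1)[OF assms(1)] by blast
  then show ?thesis
    using world_simps(1)[OF assms(1) K[of "Neg a" ?c]]
      world_simps(1)[OF assms(1) K[of "Neg b" "Neg (Or a b)"]] assms(2)
    by (auto simp: world_simps[OF assms(1)] double_neg[OF assms(1)])
qed

lemma normal:
  assumes "world \<Gamma>" "MGrz (Neg a)"
  shows "M a \<notin> \<Gamma>"
  using world_simps(1)[OF assms(1) nec[OF assms(2)]]
  by (simp add: world_simps[OF assms(1)] double_neg[OF assms(1)])

text \<open>When \<open>M b\<close> fails, conjoining \<open>a\<close> with \<open>Neg b\<close>
  keeps it possible: \<open>a\<close> implies the disjunction of this conjunction with
  \<open>b\<close>, and \<open>M\<close> is additive. The induction strengthens \<open>a\<close> by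
  one list element at a time.\<close>

lemma not_refuted:
  assumes "world \<Gamma>" "set L \<subseteq> {Neg b |b. M b \<notin> \<Gamma>}" "MGrz (imps L (Neg a))"
  shows "M a \<notin> \<Gamma>"
  using assms(2,3)
proof (induction L arbitrary: a)
  case Nil
  then show ?case using normal[OF assms(1)] by simp
next
  case (Cons c L)
  then obtain b where b: "c = Neg b" "M b \<notin> \<Gamma>"
    by auto
  let ?a = "Neg (Or (Neg a) b)"
  have "MGrz (imps L (Neg ?a))"
    by (rule MGrz_cons[of "[imps (c # L) (Neg a)]"]) (use Cons.prems(2) b in \<open>auto simp: bool_eval_imps\<close>)
  then have "M ?a \<notin> \<Gamma>"
    using Cons by simp
  moreover have "MGrz (Imp a (Or ?a b))"
    by (rule MGrz_taut) (auto simp: tautology_def)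
  ultimately show ?case
    using b(2) mono additive assms(1) by blast
qed

text \<open>The second premise says that each finite part of \<open>\<Delta>\<close> follows from
  one formula possible at \<open>\<Gamma>\<close>. A singleton \<open>\<Delta>\<close> yields the
  usual witness for a diamond; \<open>E_R_commute\<close> uses an infinite one.\<close>

lemma rel_extension:
  assumes "world \<Gamma>"
    and "\<And>L. set L \<subseteq> \<Delta> \<Longrightarrow> \<exists>a. M a \<in> \<Gamma> \<and> MGrz (Imp (imps L Bot) (Neg a))"
  shows "\<exists>\<Theta>. (\<Gamma>, \<Theta>) \<in> rel \<and> \<Delta> \<subseteq> \<Theta>"
proof -
  let ?N = "{Neg b |b. M b \<notin> \<Gamma>}"
  have "\<not> derives (?N \<union> \<Delta>) Bot"
  proof
    assume "derives (?N \<union> \<Delta>) Bot"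
    then obtain L where L: "set L \<subseteq> ?N \<union> \<Delta>" "MGrz (imps L Bot)"
      unfolding derives_def by blast
    \<comment> \<open>The refuting premises split into negations of formulas impossible at
      \<open>\<Gamma>\<close> and members of \<open>\<Delta>\<close>; the latter are absorbed into
      the single formula \<open>a\<close>.\<close>
    let ?L1 = "filter (\<lambda>b. b \<in> ?N) L" and ?L2 = "filter (\<lambda>b. b \<notin> ?N) L"
    have "set ?L2 \<subseteq> \<Delta>"
      using L(1) by auto
    then obtain a where a: "M a \<in> \<Gamma>" "MGrz (Imp (imps ?L2 Bot) (Neg a))"
      using assms(2) by blast
    have "MGrz (imps ?L1 (Neg a))"
      by (rule MGrz_cons[of "[Imp (imps ?L2 Bot) (Neg a), imps L Bot]"])
        (use L(2) a(2) in \<open>auto simp: bool_eval_imps\<close>)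
    then show False
      using not_refuted[OF assms(1), of ?L1 a] a(1) by auto
  qed
  then obtain \<Theta> where \<Theta>: "world \<Theta>" "?N \<union> \<Delta> \<subseteq> \<Theta>"
    using world_extension by blast
  then have "M a \<in> \<Gamma>" if "a \<in> \<Theta>" for a
    using that world_simps(2)[OF \<Theta>(1), of a] by blast
  then show ?thesis
    using assms(1) \<Theta> unfolding rel_def by blast
qed

lemma rel_witness:
  assumes "world \<Gamma>" "M a \<in> \<Gamma>"
  shows "\<exists>\<Theta>. (\<Gamma>, \<Theta>) \<in> rel \<and> a \<in> \<Theta>"
proof -
  have "\<exists>\<Theta>. (\<Gamma>, \<Theta>) \<in> rel \<and> {a} \<subseteq> \<Theta>"
  proof (rule rel_extension[OF assms(1)], intro exI conjI)
    fix L assume "set L \<subseteq> {a}"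
    then show "MGrz (Imp (imps L Bot) (Neg a))"
      by (intro MGrz_taut) (auto simp: tautology_def bool_eval_imps)
  qed (rule assms(2))
  then show ?thesis by blast
qed

lemma reflexive:
  assumes "world \<Gamma>" "a \<in> \<Gamma>"
  shows "M a \<in> \<Gamma>"
  using world_MP[OF assms(1) T[of "Neg a"]] assms(2)
  by (auto simp: world_simps[OF assms(1)] double_neg[OF assms(1)])

lemma transitive:
  assumes "world \<Gamma>" "M (M a) \<in> \<Gamma>"
  shows "M a \<in> \<Gamma>"
proof (rule ccontr)
  assume "M a \<notin> \<Gamma>"
  then have "M (M (Neg (Neg a))) \<notin> \<Gamma>"
    using world_MP[OF assms(1) four[of "Neg a"]]
    by (auto simp: world_simps[OF assms(1)] double_neg[OF assms(1)])
  moreover have "MGrz (Imp (M a) (M (Neg (Neg a))))"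
    by (rule MGrz_cons[of "[Imp (M a) (Neg (Neg (M (Neg (Neg a)))))]"]) (use dual1 in auto)
  ultimately show False
    using mono[OF assms(1)] assms(2) by blast
qed

lemma rel_world: "(\<Gamma>, \<Delta>) \<in> rel \<Longrightarrow> world \<Gamma> \<and> world \<Delta>"
  by (simp add: rel_def)

lemma rel_refl: "world \<Gamma> \<Longrightarrow> (\<Gamma>, \<Gamma>) \<in> rel"
  using reflexive by (simp add: rel_def)

lemma rel_trans: "(\<Gamma>, \<Delta>) \<in> rel \<Longrightarrow> (\<Delta>, \<Theta>) \<in> rel \<Longrightarrow> (\<Gamma>, \<Theta>) \<in> rel"
  using transitive by (auto simp: rel_def)

end

interpretation R: diamond Dia
proof
  fix a b
  show "MGrz (Imp (Box (Imp a b)) (Imp (Box a) (Box b)))"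
    using MGrz_subst[OF MGrz_Grz[OF Grz_K], of "\<lambda>n. if n = 0 then a else b"] by simp
  show "MGrz (Imp (Dia a) (Neg (Box (Neg a))))"
    using MGrz_subst[OF MGrz_Grz[OF Grz_dual1], of "\<lambda>_. a"] by simp
  show "MGrz (Imp (Neg (Box (Neg a))) (Dia a))"
    using MGrz_subst[OF MGrz_Grz[OF Grz_dual2], of "\<lambda>_. a"] by simp
  show "MGrz (Box a)" if "MGrz a"
    using that by (rule MGrz_nec_Box)
  show "MGrz (Imp (Box a) a)"
    using MGrz_subst[OF MGrz_Grz[OF Grz_T], of "\<lambda>_. a"] by simp
  show "MGrz (Imp (Box a) (Box (Box a)))"
    using MGrz_subst[OF MGrz_Grz[OF Grz_4], of "\<lambda>_. a"] by simp
qed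

interpretation E: diamond Some_E
proof
  fix a b
  show "MGrz (Imp (All_E (Imp a b)) (Imp (All_E a) (All_E b)))"
    using MGrz_subst[OF MGrz_K, of "\<lambda>n. if n = 0 then a else b"] by simp
  show "MGrz (Imp (Some_E a) (Neg (All_E (Neg a))))"
    using MGrz_subst[OF MGrz_dual1, of "\<lambda>_. a"] by simp
  show "MGrz (Imp (Neg (All_E (Neg a))) (Some_E a))"
    using MGrz_subst[OF MGrz_dual2, of "\<lambda>_. a"] by simp
  show "MGrz (All_E a)" if "MGrz a"
    using that by (rule MGrz_nec_All)
  show "MGrz (Imp (All_E a) a)"
    using MGrz_subst[OF MGrz_T, of "\<lambda>_. a"] by simp
  show "MGrz (Imp (All_E a) (All_E (All_E a)))"
    using MGrz_subst[OF MGrz_4, of "\<lambda>_. a"] by simp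
qed

text \<open>Otherwise \<open>Some_E (Neg (Some_E a))\<close> would lie in \<open>\<Gamma>\<close>,
  against axiom 5, because \<open>Some_E a\<close> is in \<open>\<Gamma>\<close> by
  reflexivity.\<close>

lemma E_sym:
  assumes "(\<Gamma>, \<Delta>) \<in> E.rel"
  shows "(\<Delta>, \<Gamma>) \<in> E.rel"
proof -
  have w: "world \<Gamma>" "world \<Delta>" and sub: "\<And>a. a \<in> \<Delta> \<Longrightarrow> Some_E a \<in> \<Gamma>"
    using assms by (auto simp: E.rel_def)
  have "Some_E a \<in> \<Delta>" if "a \<in> \<Gamma>" for a
  proof (rule ccontr)
    assume "Some_E a \<notin> \<Delta>"
    then have "Some_E (Neg (Some_E a)) \<in> \<Gamma>"
      using sub w(2) by (simp add: world_simps)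
    moreover have "MGrz (Imp (Some_E a) (All_E (Some_E a)))"
      using MGrz_subst[OF MGrz_5, of "\<lambda>_. a"] by simp
    ultimately show False
      using world_MP[OF w(1)] E.reflexive[OF w(1) that] world_simps(2)[OF w(1)] by blast
  qed
  then show ?thesis using w by (auto simp: E.rel_def)
qed

abbreviation conj_list :: "fm list \<Rightarrow> fm" where
  "conj_list L \<equiv> Neg (imps L Bot)"

text \<open>It suffices that \<open>\<Omega>\<close> contains \<open>Some_E a\<close> for all
  \<open>a\<close> in \<open>\<Theta>\<close>. For finitely many such \<open>a\<close> with
  conjunction \<open>c\<close>, the connecting axiom turns \<open>Some_E (Dia c)\<close> at
  \<open>\<Gamma>\<close> into \<open>Dia (Some_E c)\<close>, and \<open>Some_E c\<close> implies
  each \<open>Some_E a\<close>.\<close>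

lemma E_R_commute:
  assumes "(\<Gamma>, \<Delta>) \<in> E.rel" "(\<Delta>, \<Theta>) \<in> R.rel"
  shows "\<exists>\<Omega>. (\<Gamma>, \<Omega>) \<in> R.rel \<and> (\<Omega>, \<Theta>) \<in> E.rel"
proof -
  have w: "world \<Gamma>" "world \<Delta>" "world \<Theta>"
    using assms by (auto simp: E.rel_def R.rel_def)
  have "\<exists>\<Omega>. (\<Gamma>, \<Omega>) \<in> R.rel \<and> Some_E ` \<Theta> \<subseteq> \<Omega>"
  proof (rule R.rel_extension[OF w(1)])
    fix L
    assume "set L \<subseteq> Some_E ` \<Theta>"
    then have "\<exists>K. set K \<subseteq> \<Theta> \<and> L = map Some_E K"
    proof (induction L)
      case (Cons b L)
      then obtain c K where "c \<in> \<Theta>" "b = Some_E c" "set K \<subseteq> \<Theta>" "L = map Some_E K"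
        by auto
      then show ?case by (intro exI[of _ "c # K"]) auto
    qed auto
    then obtain K where K: "set K \<subseteq> \<Theta>" "L = map Some_E K"
      by blast
    let ?c = "conj_list K"
    have "?c \<in> \<Theta>"
      using K(1) world_simps(1)[OF w(3) MGrz_taut, of "Or (Var 0) (Neg (Var 0))"]
      by (simp add: world_simps[OF w(3)] world_imps[OF w(3)] tautology_def)
    then have "Some_E (Dia ?c) \<in> \<Gamma>"
      using assms by (auto simp: E.rel_def R.rel_def)
    moreover have "MGrz (Imp (Some_E (Dia ?c)) (Dia (Some_E ?c)))"
      using MGrz_subst[OF MGrz_conn, of "\<lambda>_. ?c"] by simp
    ultimately have "Dia (Some_E ?c) \<in> \<Gamma>"
      using world_MP[OF w(1)] by blast
    moreover have "MGrz (Imp (imps L Bot) (Neg (Some_E ?c)))"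
    proof (rule MGrz_cons[of "map (\<lambda>a. Imp (Some_E ?c) (Some_E a)) K"])
      have "MGrz (Imp ?c a)" if "a \<in> set K" for a
        using that by (intro MGrz_taut) (auto simp: tautology_def bool_eval_imps)
      then show "\<forall>b\<in>set (map (\<lambda>a. Imp (Some_E ?c) (Some_E a)) K). MGrz b"
        using E.mono_theorem by auto
    qed (auto simp: K(2) bool_eval_imps)
    ultimately show "\<exists>a. Dia a \<in> \<Gamma> \<and> MGrz (Imp (imps L Bot) (Neg a))"
      by blast
  qed
  then show ?thesis
    using E_sym w(3) by (auto simp: E.rel_def image_subset_iff dest: R.rel_world)
qed

section \<open>Finite models of class types\<close>

primrec subformulas :: "fm \<Rightarrow> fm set" where
  "subformulas (Var n) = {Var n}"
| "subformulas (Neg a) = insert (Neg a) (subformulas a)"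
| "subformulas (Or a b) = insert (Or a b) (subformulas a \<union> subformulas b)"
| "subformulas (Dia a) = insert (Dia a) (subformulas a)"
| "subformulas (Some_E a) = insert (Some_E a) (subformulas a)"

lemma finite_subformulas: "finite (subformulas a)"
  by (induction a) auto

lemma subformulas_refl: "a \<in> subformulas a"
  by (cases a) auto

lemma subformulas_trans: "b \<in> subformulas a \<Longrightarrow> subformulas b \<subseteq> subformulas a"
  by (induction a) auto

section \<open>Types and their finite realizations\<close>

definition point_type ::
  "fm set \<Rightarrow> ('w \<times> 'w) set \<Rightarrow> ('w \<times> 'w) set \<Rightarrow> (nat \<Rightarrow> 'w set) \<Rightarrow> 'w \<Rightarrow> fm set" where
  "point_type \<Sigma> R E V x = {a \<in> \<Sigma>. sat R E V x a}"

definition class_type ::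
  "fm set \<Rightarrow> ('w \<times> 'w) set \<Rightarrow> ('w \<times> 'w) set \<Rightarrow> (nat \<Rightarrow> 'w set) \<Rightarrow> 'w \<Rightarrow> fm set set" where
  "class_type \<Sigma> R E V x = point_type \<Sigma> R E V ` (E `` {x})"

definition realizes ::
  "fm set \<Rightarrow> 'w set \<Rightarrow> ('w \<times> 'w) set \<Rightarrow> ('w \<times> 'w) set \<Rightarrow> (nat \<Rightarrow> 'w set) \<Rightarrow> 'w \<Rightarrow> fm set set \<Rightarrow> bool"
  where
  "realizes \<Sigma> X R E V p T \<longleftrightarrow> finite X \<and> MS4_frame X R E \<and> antisym R \<and> (\<forall>n. V n \<subseteq> X) \<and> p \<in> X
     \<and> class_type \<Sigma> R E V p = T"

text \<open>A fixed carrier type allows the finite models of different class types to be chosen by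
  one function and glued together.\<close>

definition realizable :: "fm set \<Rightarrow> fm set set \<Rightarrow> bool" where
  "realizable \<Sigma> T \<longleftrightarrow> (\<exists>(X :: nat set) R E V p. realizes \<Sigma> X R E V p T)"

lemma sat_image:
  fixes f :: "'a \<Rightarrow> 'b"
  assumes "inj_on f X" "R \<subseteq> X \<times> X" "E \<subseteq> X \<times> X" "\<And>n. V n \<subseteq> X" "x \<in> X"
  shows "sat (map_prod f f ` R) (map_prod f f ` E) (\<lambda>n. f ` V n) (f x) a \<longleftrightarrow> sat R E V x a"
  using assms(5)
proof (induction a arbitrary: x)
  case (Var n)
  then show ?case using assms(1,4) by (auto dest: inj_onD)
next
  case (Dia a)
  have "(\<exists>y. (f x, y) \<in> map_prod f f ` R \<and> P y) \<longleftrightarrow> (\<exists>y\<in>X. (x, y) \<in> R \<and> P (f y))" for P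
    using assms(1,2) Dia.prems by (force dest: inj_onD)
  then show ?case using Dia.IH assms(2) by auto
next
  case (Some_E a)
  have "(\<exists>y. (f x, y) \<in> map_prod f f ` E \<and> P y) \<longleftrightarrow> (\<exists>y\<in>X. (x, y) \<in> E \<and> P (f y))" for P
    using assms(1,3) Some_E.prems by (force dest: inj_onD)
  then show ?case using Some_E.IH assms(3) by auto
qed auto

text \<open>The model is copied along an injection of its finite carrier into the naturals. The
  glued model, whose carrier has a sum type, is brought back into the required form this
  way.\<close>

lemma realizes_imp_realizable:
  fixes X :: "'a set"
  assumes "realizes \<Sigma> X R E V p T"
  shows "realizable \<Sigma> T"
proof -
  have fin: "finite X" and fr: "MS4_frame X R E" and "antisym R" and V: "\<And>n. V n \<subseteq> X" and "p \<in> X"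
    and T: "class_type \<Sigma> R E V p = T"
    using assms by (auto simp: realizes_def)
  note F = MS4_frameD[OF fr]
  have sub: "R \<subseteq> X \<times> X" "E \<subseteq> X \<times> X"
    using F(2,3) by auto
  obtain f :: "'a \<Rightarrow> nat" where f: "inj_on f X"
    using finite_imp_inj_to_nat_seg[OF fin] by blast
  let ?R = "map_prod f f ` R" and ?E = "map_prod f f ` E" and ?V = "\<lambda>n. f ` V n"
  have R_iff: "(f x, f y) \<in> ?R \<longleftrightarrow> (x, y) \<in> R" and E_iff: "(f x, f y) \<in> ?E \<longleftrightarrow> (x, y) \<in> E"
    if "x \<in> X" "y \<in> X" for x y
    using that f sub by (auto dest: inj_onD)
  have dom: "(u, v) \<in> ?R \<union> ?E \<Longrightarrow> \<exists>x\<in>X. \<exists>y\<in>X. u = f x \<and> v = f y" for u v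
    using sub by auto
  have sat: "sat ?R ?E ?V (f x) a \<longleftrightarrow> sat R E V x a" if "x \<in> X" for x a
    by (rule sat_image) (use f sub V that in auto)
  have "MS4_frame (f ` X) ?R ?E"
  proof (rule MS4_frameI)
    show "f ` X \<noteq> {}" "?R \<subseteq> f ` X \<times> f ` X" "?E \<subseteq> f ` X \<times> f ` X"
      using F(1) sub by auto
    show "(x, x) \<in> ?R" "(x, x) \<in> ?E" if "x \<in> f ` X" for x
      using that F(4,5) by auto
    show "(y, x) \<in> ?E" if "(x, y) \<in> ?E" for x y
      using that F(6) by auto
    show "(x, z) \<in> ?R" if h: "(x, y) \<in> ?R" "(y, z) \<in> ?R" for x y z
    proof -
      obtain x' y' z' where *: "x = f x'" "y = f y'" "z = f z'" "x' \<in> X" "y' \<in> X" "z' \<in> X"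
        using h dom by (metis UnI1)
      then show ?thesis using h F(7)[of x' y' z'] by (simp add: R_iff)
    qed
    show "(x, z) \<in> ?E" if h: "(x, y) \<in> ?E" "(y, z) \<in> ?E" for x y z
    proof -
      obtain x' y' z' where *: "x = f x'" "y = f y'" "z = f z'" "x' \<in> X" "y' \<in> X" "z' \<in> X"
        using h dom by (metis UnI2)
      then show ?thesis using h F(8)[of x' y' z'] by (simp add: E_iff)
    qed
    show "\<exists>u. (x, u) \<in> ?R \<and> (u, z) \<in> ?E" if h: "(x, y) \<in> ?E" "(y, z) \<in> ?R" for x y z
    proof -
      obtain x' y' z' where *: "x = f x'" "y = f y'" "z = f z'" "x' \<in> X" "y' \<in> X" "z' \<in> X"
        using h dom by (metis UnI1 UnI2)
      then obtain u where "(x', u) \<in> R" "(u, z') \<in> E"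
        using h F(9)[of x' y' z'] by (auto simp: E_iff R_iff)
      then show ?thesis using * by auto
    qed
  qed
  moreover have "antisym ?R"
  proof (rule antisymI)
    fix x y
    assume xy: "(x, y) \<in> ?R" "(y, x) \<in> ?R"
    then obtain x' y' where *: "x = f x'" "y = f y'" "x' \<in> X" "y' \<in> X"
      using dom by (metis UnI1)
    then show "x = y"
      using xy \<open>antisym R\<close> by (auto simp: R_iff dest: antisymD)
  qed
  moreover have "class_type \<Sigma> ?R ?E ?V (f p) = T"
  proof -
    have "?E `` {f p} = f ` (E `` {p})"
      using \<open>p \<in> X\<close> f sub(2) by (force dest: inj_onD)
    moreover have "point_type \<Sigma> ?R ?E ?V (f x) = point_type \<Sigma> R E V x" if "x \<in> X" for x
      using that by (simp add: point_type_def sat)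
    ultimately show ?thesis
      using sub(2) unfolding T[symmetric] class_type_def image_image by (auto simp: image_iff)
  qed
  moreover have "?V n \<subseteq> f ` X" for n
    using V by (intro image_mono)
  ultimately have "realizes \<Sigma> (f ` X) ?R ?E ?V (f p) T"
    using fin \<open>p \<in> X\<close> by (simp add: realizes_def)
  then show ?thesis unfolding realizable_def by blast
qed

locale grz_model =
  fixes W :: "'w set" and R E :: "('w \<times> 'w) set" and V :: "nat \<Rightarrow> 'w set" and \<phi> :: fm
  assumes frame: "MS4_frame W R E"
    and grz: "\<And>x a. x \<in> W \<Longrightarrow> sat R E V x a \<Longrightarrow>
      \<exists>y. (x, y) \<in> R \<and> sat R E V y a
        \<and> (\<forall>z w. (y, z) \<in> R \<longrightarrow> (z, w) \<in> R \<longrightarrow> sat R E V w a \<longrightarrow> sat R E V z a)"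
begin

lemmas frame_props = MS4_frameD[OF frame]

section \<open>Definability of point types and class types\<close>

definition definable :: "('w \<Rightarrow> bool) \<Rightarrow> bool" where
  "definable P \<longleftrightarrow> (\<exists>a. \<forall>x\<in>W. sat R E V x a \<longleftrightarrow> P x)"

lemma definable_sat: "definable (\<lambda>x. sat R E V x a)"
  unfolding definable_def by blast

lemma definable_const: "definable (\<lambda>_. c)"
proof -
  have "\<forall>x\<in>W. sat R E V x (if c then Or (Var 0) (Neg (Var 0)) else Neg (Or (Var 0) (Neg (Var 0)))) \<longleftrightarrow> c"
    by simp
  then show ?thesis unfolding definable_def by blast
qed

lemma definable_not:
  assumes "definable P"
  shows "definable (\<lambda>x. \<not> P x)"
proof -
  obtain a where "\<forall>x\<in>W. sat R E V x a \<longleftrightarrow> P x"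
    using assms unfolding definable_def by blast
  then have "\<forall>x\<in>W. sat R E V x (Neg a) \<longleftrightarrow> \<not> P x"
    by simp
  then show ?thesis unfolding definable_def by blast
qed

lemma definable_conj:
  assumes "definable P" "definable Q"
  shows "definable (\<lambda>x. P x \<and> Q x)"
proof -
  obtain a b where "\<forall>x\<in>W. sat R E V x a \<longleftrightarrow> P x" "\<forall>x\<in>W. sat R E V x b \<longleftrightarrow> Q x"
    using assms unfolding definable_def by blast
  then have "\<forall>x\<in>W. sat R E V x (Neg (Or (Neg a) (Neg b))) \<longleftrightarrow> P x \<and> Q x"
    by simp
  then show ?thesis unfolding definable_def by blast
qed

lemma definable_ex_E:
  assumes "definable P"
  shows "definable (\<lambda>x. \<exists>y. (x, y) \<in> E \<and> P y)"
proof -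
  obtain a where a: "\<forall>x\<in>W. sat R E V x a \<longleftrightarrow> P x"
    using assms unfolding definable_def by blast
  have "\<forall>x\<in>W. sat R E V x (Some_E a) \<longleftrightarrow> (\<exists>y. (x, y) \<in> E \<and> P y)"
    unfolding sat.simps using a frame_props(3) by blast
  then show ?thesis unfolding definable_def by blast
qed

lemma definable_iff_const: "definable P \<Longrightarrow> definable (\<lambda>x. c \<longleftrightarrow> P x)"
  by (cases c) (auto intro: definable_not)

lemma definable_ball:
  assumes "finite I" "\<And>i. i \<in> I \<Longrightarrow> definable (P i)"
  shows "definable (\<lambda>x. \<forall>i\<in>I. P i x)"
  using assms
proof (induction I)
  case empty
  then show ?case using definable_const[of True] by simp
next
  case (insert i I)
  then show ?case using definable_conj[of "P i" "\<lambda>x. \<forall>i\<in>I. P i x"] by simp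
qed

lemma definable_grz:
  assumes "definable P" "x \<in> W" "P x"
  shows "\<exists>y. (x, y) \<in> R \<and> P y \<and> (\<forall>z w. (y, z) \<in> R \<longrightarrow> (z, w) \<in> R \<longrightarrow> P w \<longrightarrow> P z)"
proof -
  obtain a where a: "\<And>x. x \<in> W \<Longrightarrow> sat R E V x a \<longleftrightarrow> P x"
    using assms(1) unfolding definable_def by blast
  then obtain y where y: "(x, y) \<in> R" "sat R E V y a"
    "\<And>z w. (y, z) \<in> R \<Longrightarrow> (z, w) \<in> R \<Longrightarrow> sat R E V w a \<Longrightarrow> sat R E V z a"
    using grz assms(2,3) by blast
  have "P z" if "(y, z) \<in> R" "(z, w) \<in> R" "P w" for z w
    using y(3)[OF that(1,2)] that a frame_props(2) by blast
  then show ?thesis using y(1,2) a frame_props(2) by blast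
qed

abbreviation "\<Sigma> \<equiv> subformulas \<phi>"
abbreviation "tp \<equiv> point_type \<Sigma> R E V"
abbreviation "ct \<equiv> class_type \<Sigma> R E V"

definition seen :: "'w \<Rightarrow> fm set set set" where
  "seen x = ct ` (R `` {x})"

lemma definable_tp: "definable (\<lambda>x. tp x = s)"
proof (cases "s \<subseteq> \<Sigma>")
  case True
  then have "(\<lambda>x. tp x = s) = (\<lambda>x. \<forall>a\<in>\<Sigma>. (a \<in> s) = sat R E V x a)"
    unfolding point_type_def by blast
  moreover have "definable (\<lambda>x. \<forall>a\<in>\<Sigma>. (a \<in> s) = sat R E V x a)"
    by (intro definable_ball finite_subformulas definable_iff_const definable_sat)
  ultimately show ?thesis by simp
next
  case False
  then have "(\<lambda>x. tp x = s) = (\<lambda>_. False)"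
    unfolding point_type_def by blast
  then show ?thesis using definable_const[of False] by simp
qed

lemma ct_subset: "ct x \<subseteq> Pow \<Sigma>"
  by (auto simp: class_type_def point_type_def)

lemma mem_ct: "s \<in> ct x \<longleftrightarrow> (\<exists>y. (x, y) \<in> E \<and> tp y = s)"
  by (auto simp: class_type_def)

text \<open>For each of the finitely many candidates \<open>s\<close>, the defining formula asserts
  or denies \<open>Some_E\<close> of a formula defining the point type \<open>s\<close>.\<close>

lemma definable_ct: "definable (\<lambda>x. ct x = T)"
proof (cases "T \<subseteq> Pow \<Sigma>")
  case True
  then have "(\<lambda>x. ct x = T) = (\<lambda>x. \<forall>s\<in>Pow \<Sigma>. (s \<in> T) = (\<exists>y. (x, y) \<in> E \<and> tp y = s))"
    unfolding mem_ct[symmetric] using ct_subset by blast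
  moreover have "definable (\<lambda>x. \<forall>s\<in>Pow \<Sigma>. (s \<in> T) = (\<exists>y. (x, y) \<in> E \<and> tp y = s))"
    by (intro definable_ball definable_iff_const definable_ex_E definable_tp)
      (simp add: finite_subformulas)
  ultimately show ?thesis by simp
next
  case False
  then have "(\<lambda>x. ct x = T) = (\<lambda>_. False)"
    using ct_subset by blast
  then show ?thesis using definable_const[of False] by simp
qed

lemma ct_E:
  assumes "(x, y) \<in> E"
  shows "ct x = ct y"
proof -
  have "E `` {x} = E `` {y}"
    using assms frame_props(6,8) by blast
  then show ?thesis by (simp add: class_type_def)
qed

lemma finite_seen: "finite (seen x)"
proof (rule finite_subset)
  show "seen x \<subseteq> Pow (Pow \<Sigma>)"
    using ct_subset by (auto simp: seen_def)
qed (simp add: finite_subformulas)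

lemma mem_seen: "T \<in> seen x \<longleftrightarrow> (\<exists>y. (x, y) \<in> R \<and> ct y = T)"
  by (auto simp: seen_def)

lemma seen_R: "(x, y) \<in> R \<Longrightarrow> seen y \<subseteq> seen x"
  unfolding subset_iff mem_seen using frame_props(7) by blast

text \<open>Commutation replaces an \<open>R\<close>-step from \<open>y\<close> by one from
  \<open>x\<close> into the same \<open>E\<close>-class, and class types are constant on
  \<open>E\<close>-classes.\<close>

lemma seen_E_subset: "(x, y) \<in> E \<Longrightarrow> seen y \<subseteq> seen x"
  unfolding subset_iff mem_seen using frame_props(9) ct_E by metis

lemma seen_E: "(x, y) \<in> E \<Longrightarrow> seen x = seen y"
  using seen_E_subset frame_props(6) by blast

lemma sat_iff_tp: "a \<in> \<Sigma> \<Longrightarrow> sat R E V x a \<longleftrightarrow> a \<in> tp x"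
  by (simp add: point_type_def)

lemma tp_eq_sat: "tp x = tp y \<Longrightarrow> a \<in> \<Sigma> \<Longrightarrow> sat R E V x a \<longleftrightarrow> sat R E V y a"
  by (simp add: sat_iff_tp)

end

text \<open>\<open>N\<close> supplies the points of the new lowest class. By \<open>N_R\<close>, an
  \<open>R\<close>-step leaving \<open>N\<close> ends in a class type other than \<open>T\<close>,
  for which \<open>S_realizable\<close> provides a finite model.\<close>

locale region = grz_model +
  fixes N T S
  assumes N_W: "N \<subseteq> W" and N_ne: "N \<noteq> {}"
    and N_ct: "\<And>y. y \<in> N \<Longrightarrow> ct y = T" and N_seen: "\<And>y. y \<in> N \<Longrightarrow> seen y = S"
    and N_E: "\<And>y z. y \<in> N \<Longrightarrow> (y, z) \<in> E \<Longrightarrow> z \<in> N"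
    and N_R: "\<And>y z. y \<in> N \<Longrightarrow> (y, z) \<in> R \<Longrightarrow> ct z = T \<Longrightarrow> z \<in> N"
    and S_realizable: "\<And>U. U \<in> S \<Longrightarrow> U \<noteq> T \<Longrightarrow> realizable \<Sigma> U"
begin

section \<open>Finite sets of witnesses inside the region\<close>

definition ahead :: "'a \<Rightarrow> fm set set" where
  "ahead y = tp ` (R `` {y} \<inter> N)"

text \<open>
  Irreflexive by construction, although \<open>R\<close> itself may contain proper clusters: the canonical frame
  need not be antisymmetric.
\<close>

definition below :: "'a \<Rightarrow> 'a \<Rightarrow> bool" where
  "below y z \<longleftrightarrow> (y, z) \<in> R \<and> tp y \<notin> ahead z"

text \<open>The three ways to satisfy a diamond at \<open>y\<close> in the glued model: at
  \<open>y\<close> itself, in one of the finite models placed above, or at a point of the new class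
  strictly above \<open>y\<close>.\<close>

definition has_witness :: "'a set \<Rightarrow> 'a \<Rightarrow> fm \<Rightarrow> bool" where
  "has_witness A y a \<longleftrightarrow> sat R E V y a \<or> (\<exists>z. (y, z) \<in> R \<and> z \<notin> N \<and> sat R E V z a)
     \<or> (\<exists>z\<in>A. below y z \<and> sat R E V z a)"

definition witnessed :: "'a set \<Rightarrow> bool" where
  "witnessed A \<longleftrightarrow> (\<forall>y\<in>A. \<forall>a. Dia a \<in> \<Sigma> \<longrightarrow> sat R E V y (Dia a) \<longrightarrow> has_witness A y a)"

lemma has_witness_mono: "has_witness A y a \<Longrightarrow> A \<subseteq> B \<Longrightarrow> has_witness B y a"
  unfolding has_witness_def by blast

lemma mem_ahead: "s \<in> ahead y \<longleftrightarrow> (\<exists>z\<in>N. (y, z) \<in> R \<and> tp z = s)"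
  by (auto simp: ahead_def)

lemma ahead_R: "(y, z) \<in> R \<Longrightarrow> ahead z \<subseteq> ahead y"
  unfolding subset_iff mem_ahead using frame_props(7) by blast

lemma finite_ahead: "finite (ahead y)"
proof (rule finite_subset)
  show "ahead y \<subseteq> Pow \<Sigma>"
    by (auto simp: ahead_def point_type_def)
qed (simp add: finite_subformulas)

lemma tp_ahead: "y \<in> N \<Longrightarrow> tp y \<in> ahead y"
  unfolding mem_ahead using frame_props(4) N_W by blast

text \<open>The types ahead only shrink along \<open>R\<close>, so a type lost at \<open>y\<close>
  is still lost at \<open>z\<close>.\<close>

lemma below_trans: "below x y \<Longrightarrow> below y z \<Longrightarrow> below x z"
  unfolding below_def using frame_props(7) ahead_R by blast

lemma below_irrefl: "y \<in> N \<Longrightarrow> \<not> below y y"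
  unfolding below_def using tp_ahead by blast

lemma witnessed_Un: "(\<And>A. A \<in> \<A> \<Longrightarrow> witnessed A) \<Longrightarrow> witnessed (\<Union>\<A>)"
  unfolding witnessed_def using has_witness_mono[OF _ Union_upper] by blast

lemma Dia_subformula: "Dia a \<in> \<Sigma> \<Longrightarrow> a \<in> \<Sigma>"
  using subformulas_trans[of "Dia a" \<phi>] subformulas_refl[of a] by auto

lemma Some_E_subformula: "Some_E a \<in> \<Sigma> \<Longrightarrow> a \<in> \<Sigma>"
  using subformulas_trans[of "Some_E a" \<phi>] subformulas_refl[of a] by auto

text \<open>Induction on the number of types ahead. The Grzegorczyk axiom moves \<open>y\<close> to
  a point of the same type that never regains this type inside \<open>N\<close> after leaving it.
  Its successors in \<open>N\<close> of other types have fewer types ahead, and their witnessed sets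
  supply the missing witnesses.\<close>

lemma ex_finite_witnessed:
  assumes "y \<in> N"
  shows "\<exists>A y'. finite A \<and> A \<subseteq> N \<and> witnessed A \<and> y' \<in> A \<and> (y, y') \<in> R \<and> tp y' = tp y"
  using assms
proof (induction "card (ahead y)" arbitrary: y rule: less_induct)
  case less
  \<comment> \<open>Fixing the class type as well keeps \<open>y'\<close> in \<open>N\<close>, by
    \<open>N_R\<close>.\<close>
  let ?P = "\<lambda>x. tp x = tp y \<and> ct x = T"
  have "definable ?P"
    by (intro definable_conj definable_tp definable_ct)
  then obtain y' where y': "(y, y') \<in> R" "?P y'"
    and leave: "\<And>z w. (y', z) \<in> R \<Longrightarrow> (z, w) \<in> R \<Longrightarrow> ?P w \<Longrightarrow> ?P z"
    using definable_grz[of ?P y] less.prems N_W N_ct by blast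
  have "y' \<in> N"
    using N_R less.prems y' by blast
  \<comment> \<open>The formulas for which \<open>y'\<close> needs a witness elsewhere in
    \<open>N\<close>.\<close>
  define B where "B = {a. Dia a \<in> \<Sigma> \<and> sat R E V y' (Dia a) \<and> \<not> sat R E V y' a
    \<and> \<not> (\<exists>z. (y', z) \<in> R \<and> z \<notin> N \<and> sat R E V z a)}"
  have "B \<subseteq> \<Sigma>"
    using Dia_subformula by (auto simp: B_def)
  then have "finite B"
    using finite_subformulas finite_subset by blast
  have "\<exists>A z. finite A \<and> A \<subseteq> N \<and> witnessed A \<and> z \<in> A \<and> below y' z \<and> sat R E V z a" if "a \<in> B" for a
  proof -
    have "a \<in> \<Sigma>" "\<not> sat R E V y' a" using \<open>a \<in> B\<close> \<open>B \<subseteq> \<Sigma>\<close> by (auto simp: B_def)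
    obtain z where z: "(y', z) \<in> R" "z \<in> N" "sat R E V z a"
      using \<open>a \<in> B\<close> by (auto simp: B_def)
    have "tp z \<noteq> tp y'"
      using tp_eq_sat[of z y' a] z(3) \<open>a \<in> \<Sigma>\<close> \<open>\<not> sat R E V y' a\<close> by blast
    \<comment> \<open>A later point of \<open>N\<close> with the type of \<open>y'\<close> would, by
      \<open>leave\<close>, force that type on \<open>z\<close>; but \<open>z\<close> satisfies
      \<open>a\<close> and \<open>y'\<close> does not.\<close>
    have left: "tp y' \<notin> ahead z"
    proof
      assume "tp y' \<in> ahead z"
      then obtain w where "w \<in> N" "(z, w) \<in> R" "tp w = tp y'"
        unfolding mem_ahead by blast
      then show False
        using leave[of z w] z(1) y'(2) N_ct \<open>tp z \<noteq> tp y'\<close> by simp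
    qed
    have "ahead z \<subseteq> ahead y'" "ahead y' \<subseteq> ahead y"
      using ahead_R z(1) y'(1) by auto
    then have "ahead z \<subset> ahead y"
      using left tp_ahead[OF \<open>y' \<in> N\<close>] by blast
    then have "card (ahead z) < card (ahead y)"
      by (rule psubset_card_mono[OF finite_ahead])
    from less.hyps[OF this z(2)] obtain A z' where
      A: "finite A" "A \<subseteq> N" "witnessed A" "z' \<in> A" "(z, z') \<in> R" "tp z' = tp z"
      by blast
    have "below y' z'"
      unfolding below_def using frame_props(7)[OF z(1) A(5)] left ahead_R[OF A(5)] by blast
    moreover have "sat R E V z' a"
      using tp_eq_sat[OF A(6) \<open>a \<in> \<Sigma>\<close>] z(3) by simp
    ultimately show ?thesis using A by blast
  qed
  then obtain f g where fg: "\<And>a. a \<in> B \<Longrightarrow> finite (f a) \<and> f a \<subseteq> N \<and> witnessed (f a) \<and> g a \<in> f a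
      \<and> below y' (g a) \<and> sat R E V (g a) a"
    by metis
  let ?A = "insert y' (\<Union>(f ` B))"
  have "witnessed (\<Union>(f ` B))"
    using fg by (intro witnessed_Un) auto
  then have "has_witness ?A x a" if "x \<in> \<Union>(f ` B)" "Dia a \<in> \<Sigma>" "sat R E V x (Dia a)" for x a
    using that has_witness_mono[of "\<Union>(f ` B)" x a ?A] unfolding witnessed_def by blast
  moreover have "has_witness ?A y' a" if "Dia a \<in> \<Sigma>" "sat R E V y' (Dia a)" for a
  proof (cases "a \<in> B")
    case True
    then show ?thesis using fg[of a] unfolding has_witness_def by blast
  next
    case False
    then show ?thesis using that unfolding B_def has_witness_def by blast
  qed
  ultimately have "witnessed ?A"
    unfolding witnessed_def by blast
  moreover have "finite ?A" "?A \<subseteq> N"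
    using fg \<open>finite B\<close> \<open>y' \<in> N\<close> by auto
  ultimately show ?case using y' by blast
qed

lemma tp_T: "y \<in> N \<Longrightarrow> tp y \<in> T"
  using N_ct[of y] mem_ct[of "tp y" y] frame_props(5) N_W by blast

text \<open>All types in \<open>T\<close> occur in the \<open>E\<close>-class of one point of
  \<open>N\<close>, and \<open>N_E\<close> keeps that class inside \<open>N\<close>. The witnessed
  sets obtained for these types are united.\<close>

lemma ex_finite_block: "\<exists>A. finite A \<and> A \<subseteq> N \<and> witnessed A \<and> tp ` A = T"
proof -
  obtain x where "x \<in> N" using N_ne by blast
  have "\<exists>A y. finite A \<and> A \<subseteq> N \<and> witnessed A \<and> y \<in> A \<and> tp y = s" if "s \<in> T" for s
  proof -
    obtain y where "(x, y) \<in> E" "tp y = s"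
      using N_ct[OF \<open>x \<in> N\<close>] \<open>s \<in> T\<close> mem_ct by blast
    then show ?thesis using ex_finite_witnessed[of y] N_E[OF \<open>x \<in> N\<close>] by metis
  qed
  then obtain f g where fg: "\<And>s. s \<in> T \<Longrightarrow> finite (f s) \<and> f s \<subseteq> N \<and> witnessed (f s) \<and> g s \<in> f s \<and> tp (g s) = s"
    by metis
  have "finite T"
    using ct_subset[of x] N_ct[OF \<open>x \<in> N\<close>] finite_subformulas by (metis finite_Pow_iff finite_subset)
  have "tp ` \<Union>(f ` T) \<subseteq> T"
    using fg tp_T by blast
  moreover have "T \<subseteq> tp ` \<Union>(f ` T)"
  proof
    fix s assume "s \<in> T"
    then show "s \<in> tp ` \<Union>(f ` T)"
      using fg[of s] by (intro image_eqI[of _ _ "g s"]) auto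
  qed
  moreover have "witnessed (\<Union>(f ` T))"
    using fg by (intro witnessed_Un) auto
  ultimately show ?thesis
    using fg \<open>finite T\<close> by (intro exI[of _ "\<Union>(f ` T)"]) (simp add: UN_least)
qed

end

section \<open>Gluing a new class below finite models\<close>

context region
begin

text \<open>
  For the commutation of \<open>E\<close> and \<open>R\<close> in the glued model it suffices that all points of the new class
  see the same class types; they need not be \<open>E\<close>-related in the original model.
\<close>

lemma realizable_T: "realizable \<Sigma> T"
proof -
  obtain A where A: "finite A" "A \<subseteq> N" "witnessed A" "tp ` A = T"
    using ex_finite_block by blast
  define I where "I = S - {T}"
  have "\<forall>U. \<exists>M. U \<in> I \<longrightarrow> (case M of (X :: nat set, R, E, V, p) \<Rightarrow> realizes \<Sigma> X R E V p U)"
    using S_realizable unfolding I_def realizable_def by fast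
  then obtain M where M: "\<And>U. U \<in> I \<Longrightarrow>
      (case M U of (X :: nat set, R, E, V, p) \<Rightarrow> realizes \<Sigma> X R E V p U)"
    by metis
  define XX where "XX U = fst (M U)" for U
  define RR where "RR U = fst (snd (M U))" for U
  define EE where "EE U = fst (snd (snd (M U)))" for U
  define VV where "VV U = fst (snd (snd (snd (M U))))" for U
  define pp where "pp U = snd (snd (snd (snd (M U))))" for U
  have real: "realizes \<Sigma> (XX U) (RR U) (EE U) (VV U) (pp U) U" if "U \<in> I" for U
    using M[OF that] unfolding XX_def RR_def EE_def VV_def pp_def by (auto split: prod.splits)
  have fr: "MS4_frame (XX U) (RR U) (EE U)" and fin: "finite (XX U)" and anti: "antisym (RR U)"
    and VV: "VV U n \<subseteq> XX U" and pp: "pp U \<in> XX U"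
    and ct_pp: "class_type \<Sigma> (RR U) (EE U) (VV U) (pp U) = U" if "U \<in> I" for U n
    using real[OF that] by (simp_all add: realizes_def)
  note H = MS4_frameD[OF fr]
  define ptp where "ptp U = point_type \<Sigma> (RR U) (EE U) (VV U)" for U
  have block: "\<exists>q. (pp U, q) \<in> EE U \<and> ptp U q = s" if "U \<in> I" "s \<in> U" for U s
  proof -
    have "s \<in> ptp U ` (EE U `` {pp U})"
      using ct_pp[OF that(1)] that(2) unfolding class_type_def ptp_def by simp
    then show ?thesis by auto
  qed

  \<comment> \<open>A successor \<open>v\<close> of class type \<open>U\<close> is represented by
    every \<open>q0\<close> of its type in the class of \<open>pp U\<close>. Closing upwards under
    \<open>RR U\<close> makes the glued relation transitive.\<close>
  define link where "link y U q \<longleftrightarrow> U \<in> I \<and> (\<exists>v q0. (y, v) \<in> R \<and> ct v = U \<and> (pp U, q0) \<in> EE U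
      \<and> ptp U q0 = tp v \<and> (q0, q) \<in> RR U)" for y U q
  have link_mono: "link y U q" if "(y, z) \<in> R" "link z U q" for y z U q
    using that frame_props(7) unfolding link_def by blast
  have link_trans: "link y U r" if "link y U q" "(q, r) \<in> RR U" for y U q r
    using that H(7) unfolding link_def by blast
  have link_X: "U \<in> I \<and> q \<in> XX U" if "link y U q" for y U q
    using that H(2) unfolding link_def by blast
  have tp_ct: "tp z \<in> ct z" if "z \<in> W" for z
    using that frame_props(5) mem_ct by blast
  have I_ex: "\<exists>v. (y, v) \<in> R \<and> ct v = U" if "U \<in> I" "y \<in> A" for y U
    using that A(2) N_seen[of y] mem_seen[of U y] unfolding I_def by blast

  \<comment> \<open>The block \<open>A\<close> stands for \<open>T\<close>; each other class type in
    \<open>S\<close> contributes its model, and the tag \<open>U\<close> keeps these models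
    disjoint.\<close>
  define X where "X = Inl ` A \<union> Inr ` (SIGMA U:I. XX U)"
  define RG where "RG = {(x, y). case x of
      Inl a \<Rightarrow> (case y of Inl b \<Rightarrow> a \<in> A \<and> b \<in> A \<and> (a = b \<or> below a b)
                      | Inr (U, q) \<Rightarrow> a \<in> A \<and> link a U q)
    | Inr (U, q) \<Rightarrow> (case y of Inl _ \<Rightarrow> False | Inr (U', r) \<Rightarrow> U' = U \<and> U \<in> I \<and> (q, r) \<in> RR U)}"
  define EG where "EG = {(x, y). case x of
      Inl a \<Rightarrow> (case y of Inl b \<Rightarrow> a \<in> A \<and> b \<in> A | Inr _ \<Rightarrow> False)
    | Inr (U, q) \<Rightarrow> (case y of Inl _ \<Rightarrow> False | Inr (U', r) \<Rightarrow> U' = U \<and> U \<in> I \<and> (q, r) \<in> EE U)}"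
  define VG where "VG n = Inl ` (A \<inter> V n) \<union> Inr ` (SIGMA U:I. VV U n)" for n
  have RG: "(Inl a, Inl b) \<in> RG \<longleftrightarrow> a \<in> A \<and> b \<in> A \<and> (a = b \<or> below a b)"
    "(Inl a, Inr (U, r)) \<in> RG \<longleftrightarrow> a \<in> A \<and> link a U r"
    "(Inr (U', q), Inl b) \<in> RG \<longleftrightarrow> False"
    "(Inr (U', q), Inr (U, r)) \<in> RG \<longleftrightarrow> U = U' \<and> U' \<in> I \<and> (q, r) \<in> RR U'" for a b U U' q r
    by (simp_all add: RG_def)
  have EG: "(Inl a, Inl b) \<in> EG \<longleftrightarrow> a \<in> A \<and> b \<in> A" "(Inl a, Inr w) \<in> EG \<longleftrightarrow> False"
    "(Inr (U', q), Inl b) \<in> EG \<longleftrightarrow> False"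
    "(Inr (U', q), Inr (U, r)) \<in> EG \<longleftrightarrow> U = U' \<and> U' \<in> I \<and> (q, r) \<in> EE U'" for a b U U' q r w
    by (simp_all add: EG_def)
  have VG: "Inl a \<in> VG n \<longleftrightarrow> a \<in> A \<and> a \<in> V n" "Inr (U, q) \<in> VG n \<longleftrightarrow> U \<in> I \<and> q \<in> VV U n" for a U q n
    by (auto simp: VG_def)
  have X: "Inl a \<in> X \<longleftrightarrow> a \<in> A" "Inr (U, q) \<in> X \<longleftrightarrow> U \<in> I \<and> q \<in> XX U" for a U q
    by (auto simp: X_def)
  have sum_cases: "thesis" if "\<And>a. x = Inl a \<Longrightarrow> thesis" "\<And>U q. x = Inr (U, q) \<Longrightarrow> thesis"
    for x :: "'a + fm set set \<times> nat" and thesis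
    using that by (metis obj_sumE surj_pair)
  have below_R: "(a, b) \<in> R" if "a = b \<or> below a b" "a \<in> A" for a b
    using that frame_props(4) A(2) N_W unfolding below_def by blast

  have X_ne: "X \<noteq> {}"
    using A(4) N_ne tp_T X(1) by (metis empty_iff image_is_empty ex_in_conv)
  have frame_G: "MS4_frame X RG EG"
  proof (rule MS4_frameI)
    show "X \<noteq> {}" by (rule X_ne)
    show "RG \<subseteq> X \<times> X"
    proof (rule subrelI)
      fix x y assume "(x, y) \<in> RG"
      then show "(x, y) \<in> X \<times> X"
        using H(2) link_X by (cases x rule: sum_cases; cases y rule: sum_cases) (auto simp: RG X)
    qed
    show "EG \<subseteq> X \<times> X"
    proof (rule subrelI)
      fix x y assume "(x, y) \<in> EG"
      then show "(x, y) \<in> X \<times> X"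
        using H(3) by (cases x rule: sum_cases; cases y rule: sum_cases) (auto simp: EG X)
    qed
    show "(x, x) \<in> RG" if "x \<in> X" for x
      using that H(4) by (cases x rule: sum_cases) (auto simp: RG X)
    show "(x, x) \<in> EG" if "x \<in> X" for x
      using that H(5) by (cases x rule: sum_cases) (auto simp: EG X)
    show "(y, x) \<in> EG" if "(x, y) \<in> EG" for x y
      using that H(6) by (cases x rule: sum_cases; cases y rule: sum_cases) (auto simp: EG)
    show "(x, z) \<in> EG" if "(x, y) \<in> EG" "(y, z) \<in> EG" for x y z
      using that by (cases x rule: sum_cases; cases y rule: sum_cases; cases z rule: sum_cases)
        (simp_all add: EG, metis H(8))
    show "(x, z) \<in> RG" if xyz: "(x, y) \<in> RG" "(y, z) \<in> RG" for x y z
    proof (cases x rule: sum_cases)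
      case x: (1 a)
      show ?thesis
      proof (cases y rule: sum_cases)
        case y: (1 b)
        have ab: "a \<in> A" "a = b \<or> below a b" "(a, b) \<in> R"
          using xyz(1) below_R by (simp_all add: x y RG)
        show ?thesis
        proof (cases z rule: sum_cases)
          case (1 c)
          then show ?thesis using ab xyz(2) below_trans by (auto simp: x y RG)
        next
          case (2 U q)
          then show ?thesis using ab xyz(2) link_mono by (auto simp: x y RG)
        qed
      next
        case y: (2 U q)
        then show ?thesis
          using xyz link_trans by (cases z rule: sum_cases) (auto simp: x RG)
      qed
    next
      case x: (2 U q)
      then show ?thesis
        using xyz by (cases y rule: sum_cases; cases z rule: sum_cases) (simp_all add: x RG, metis H(7))
    qed
    show "\<exists>u. (x, u) \<in> RG \<and> (u, z) \<in> EG" if xyz: "(x, y) \<in> EG" "(y, z) \<in> RG" for x y z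
    proof (cases x rule: sum_cases)
      case x: (1 a)
      then obtain b where y: "y = Inl b" "a \<in> A" "b \<in> A"
        using xyz(1) by (cases y rule: sum_cases) (auto simp: EG)
      show ?thesis
      proof (cases z rule: sum_cases)
        \<comment> \<open>The new points form a single \<open>EG\<close>-class, so \<open>x\<close>
          itself serves.\<close>
        case (1 c)
        then show ?thesis
          using xyz(2) y x by (intro exI[of _ x]) (auto simp: RG EG)
      next
        case z: (2 U q)
        then obtain q0 where U: "U \<in> I" "(pp U, q0) \<in> EE U" "(q0, q) \<in> RR U"
          using xyz(2) y by (auto simp: RG link_def)
        \<comment> \<open>The point \<open>a\<close> also sees the class type \<open>U\<close>, at
          some \<open>w\<close>. A representative \<open>q1\<close> of \<open>w\<close> is
          \<open>EE U\<close>-related to \<open>q0\<close>, so commutation inside the model of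
          \<open>U\<close> yields the required \<open>r\<close>.\<close>
        obtain w where w: "(a, w) \<in> R" "ct w = U"
          using I_ex U(1) y(2) by blast
        obtain q1 where q1: "(pp U, q1) \<in> EE U" "ptp U q1 = tp w"
          using block[OF U(1)] w tp_ct frame_props(2) by blast
        obtain r where r: "(q1, r) \<in> RR U" "(r, q) \<in> EE U"
          using H(9)[OF U(1) H(8)[OF U(1) H(6)[OF U(1) q1(1)] U(2)] U(3)] by blast
        have "link a U r"
          unfolding link_def using U(1) w q1 r(1) by blast
        then show ?thesis
          using x z y(2) U(1) r(2) by (intro exI[of _ "Inr (U, r)"]) (simp add: RG EG)
      qed
    next
      case x: (2 U q)
      obtain r where y: "y = Inr (U, r)" "U \<in> I" "(q, r) \<in> EE U"
        using xyz(1) x by (cases y rule: sum_cases) (auto simp: EG)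
      obtain t where z: "z = Inr (U, t)" "(r, t) \<in> RR U"
        using xyz(2) y by (cases z rule: sum_cases) (auto simp: RG)
      obtain u where "(q, u) \<in> RR U" "(u, t) \<in> EE U"
        using H(9)[OF y(2,3) z(2)] by blast
      then show ?thesis
        using x y(2) z(1) by (intro exI[of _ "Inr (U, u)"]) (simp add: RG EG)
    qed
  qed
  have anti_G: "antisym RG"
  proof (rule antisymI)
    fix x y assume xy: "(x, y) \<in> RG" "(y, x) \<in> RG"
    show "x = y"
    proof (cases x rule: sum_cases)
      case x: (1 a)
      then obtain b where y: "y = Inl b"
        using xy(2) by (cases y rule: sum_cases) (auto simp: RG)
      then have "a \<in> N" "a = b \<or> below a b \<and> below b a"
        using xy x A(2) by (auto simp: RG)
      then show ?thesis using x y below_trans below_irrefl by blast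
    next
      case x: (2 U q)
      then obtain r where y: "y = Inr (U, r)"
        using xy(1) by (cases y rule: sum_cases) (auto simp: RG)
      then have "q = r"
        using xy x antisymD[OF anti, of U q r] by (simp add: RG)
      then show ?thesis using x y by simp
    qed
  qed

  \<comment> \<open>Neither relation leads out of the copy of a finite model, so truth there is
    unchanged for all formulas.\<close>
  have sat_Inr: "sat RG EG VG (Inr (U, q)) a \<longleftrightarrow> sat (RR U) (EE U) (VV U) q a" if "U \<in> I" for U q a
    using that by (induction a arbitrary: q) (auto simp: VG split_sum_ex RG EG)
  have sat_Inl: "sat RG EG VG (Inl y) a \<longleftrightarrow> sat R E V y a" if "y \<in> A" "a \<in> \<Sigma>" for y a
    using that
  proof (induction a arbitrary: y)
    case (Var n)
    then show ?case by (simp add: VG)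
  next
    case (Neg a)
    then show ?case
      using subformulas_trans[of "Neg a" \<phi>] subformulas_refl[of a] by auto
  next
    case (Or a b)
    then show ?case
      using subformulas_trans[of "Or a b" \<phi>] subformulas_refl[of a] subformulas_refl[of b] by auto
  next
    case (Dia a)
    have a: "a \<in> \<Sigma>"
      using Dia.prems(2) by (rule Dia_subformula)
    show ?case
    proof
      assume "sat RG EG VG (Inl y) (Dia a)"
      then obtain x where x: "(Inl y, x) \<in> RG" "sat RG EG VG x a"
        by auto
      show "sat R E V y (Dia a)"
      proof (cases x rule: sum_cases)
        case (1 b)
        then have "(y, b) \<in> R" "b \<in> A"
          using x(1) below_R by (auto simp: RG)
        then show ?thesis using x(2) 1 Dia.IH[of b] a by auto
      next
        case (2 U q)
        then have "link y U q"
          using x(1) by (simp add: RG)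
        then obtain v q0 where v: "U \<in> I" "(y, v) \<in> R" "ptp U q0 = tp v" "(q0, q) \<in> RR U"
          unfolding link_def by blast
        \<comment> \<open>Only the subformula \<open>Dia a\<close> is transferred: \<open>q0\<close>
          satisfies it because it sees \<open>q\<close>, hence so does \<open>v\<close>, which has
          the same type.\<close>
        then have "sat (RR U) (EE U) (VV U) q0 (Dia a)"
          using x(2) 2 sat_Inr by auto
        then have "Dia a \<in> ptp U q0"
          using Dia.prems(2) by (simp add: ptp_def point_type_def)
        then have "sat R E V v (Dia a)"
          using v(3) by (simp add: point_type_def)
        then show ?thesis using frame_props(7)[OF v(2)] by auto
      qed
    next
      assume "sat R E V y (Dia a)"
      then have "has_witness A y a"
        using A(3) Dia.prems unfolding witnessed_def by blast
      then consider "sat R E V y a" | z where "(y, z) \<in> R" "z \<notin> N" "sat R E V z a"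
        | z where "z \<in> A" "below y z" "sat R E V z a"
        unfolding has_witness_def by blast
      then show "sat RG EG VG (Inl y) (Dia a)"
      proof cases
        case 1
        then have "(Inl y, Inl y) \<in> RG" "sat RG EG VG (Inl y) a"
          using Dia.prems(1) Dia.IH a by (simp_all add: RG)
        then show ?thesis unfolding sat.simps by blast
      next
        case (2 z)
        let ?U = "ct z"
        have "z \<in> W" using frame_props(2)[OF 2(1)] by blast
        \<comment> \<open>A witness outside \<open>N\<close> has class type different from
          \<open>T\<close> by \<open>N_R\<close>, so a point of its type is available in the finite
          model of that class type.\<close>
        have "?U \<noteq> T"
          using N_R 2 Dia.prems(1) A(2) by blast
        moreover have "?U \<in> S"
          using N_seen[of y] Dia.prems(1) A(2) mem_seen 2(1) by blast
        ultimately have U: "?U \<in> I" by (simp add: I_def)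
        then obtain q where q: "(pp ?U, q) \<in> EE ?U" "ptp ?U q = tp z"
          using block tp_ct[OF \<open>z \<in> W\<close>] by blast
        then have "(q, q) \<in> RR ?U"
          using H(3,4)[OF U] by blast
        then have "link y ?U q"
          unfolding link_def using U 2(1) q by blast
        moreover have "a \<in> ptp ?U q"
          using q(2) 2(3) a by (simp add: point_type_def)
        then have "sat RG EG VG (Inr (?U, q)) a"
          using sat_Inr[OF U] by (simp add: ptp_def point_type_def)
        ultimately show ?thesis
          using Dia.prems(1) unfolding sat.simps by (intro exI[of _ "Inr (?U, q)"]) (simp add: RG)
      next
        case (3 z)
        then have "(Inl y, Inl z) \<in> RG" "sat RG EG VG (Inl z) a"
          using Dia.prems(1) Dia.IH a by (simp_all add: RG)
        then show ?thesis unfolding sat.simps by blast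
      qed
    qed
  next
    case (Some_E a)
    have a: "a \<in> \<Sigma>"
      using Some_E.prems(2) by (rule Some_E_subformula)
    \<comment> \<open>Both sides depend only on \<open>T\<close>: the types in \<open>A\<close> are
      exactly those in \<open>T\<close>, and so are the types in the original \<open>E\<close>-class
      of \<open>y\<close>.\<close>
    have "sat RG EG VG (Inl y) (Some_E a) \<longleftrightarrow> (\<exists>z\<in>A. sat R E V z a)"
      using Some_E a by (auto simp: split_sum_ex EG)
    also have "\<dots> \<longleftrightarrow> (\<exists>s\<in>T. a \<in> s)"
      unfolding A(4)[symmetric] using a by (simp add: sat_iff_tp)
    also have "\<dots> \<longleftrightarrow> (\<exists>s\<in>ct y. a \<in> s)"
      using N_ct[of y] Some_E.prems(1) A(2) by (simp add: subset_iff)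
    also have "\<dots> \<longleftrightarrow> sat R E V y (Some_E a)"
      using a by (auto simp: class_type_def sat_iff_tp)
    finally show ?case .
  qed

  obtain y where "y \<in> A"
    using A(4) N_ne tp_T by blast
  have "EG `` {Inl y} = Inl ` A"
  proof (rule set_eqI)
    fix x show "x \<in> EG `` {Inl y} \<longleftrightarrow> x \<in> Inl ` A"
      using \<open>y \<in> A\<close> by (cases x rule: sum_cases) (auto simp: EG)
  qed
  moreover have "point_type \<Sigma> RG EG VG (Inl z) = tp z" if "z \<in> A" for z
    using sat_Inl[OF that] by (auto simp: point_type_def)
  ultimately have "class_type \<Sigma> RG EG VG (Inl y) = T"
    unfolding class_type_def A(4)[symmetric] by (simp add: image_image)
  moreover have "VG n \<subseteq> X" for n
    unfolding VG_def X_def using VV by blast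
  moreover have "finite I"
    using finite_seen N_ne N_seen unfolding I_def by (metis all_not_in_conv finite_Diff)
  then have "finite X"
    using A(1) fin by (auto simp: X_def)
  ultimately have "realizes \<Sigma> X RG EG VG (Inl y) T"
    unfolding realizes_def using frame_G anti_G \<open>y \<in> A\<close> by (simp add: X)
  then show ?thesis by (rule realizes_imp_realizable)
qed

end

section \<open>The minimal counterexample\<close>

lemma (in grz_model) all_realizable:
  assumes "x \<in> W"
  shows "realizable \<Sigma> (ct x)"
proof (rule ccontr)
  assume "\<not> realizable \<Sigma> (ct x)"
  then have "\<exists>y. (y \<in> W \<and> \<not> realizable \<Sigma> (ct y)) \<and>
      (\<forall>z. z \<in> W \<and> \<not> realizable \<Sigma> (ct z) \<longrightarrow> card (seen y) \<le> card (seen z))"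
    using assms by (intro ex_has_least_nat[of _ x]) blast
  then obtain x0 where x0: "x0 \<in> W" "\<not> realizable \<Sigma> (ct x0)"
    and min: "\<And>z. z \<in> W \<Longrightarrow> \<not> realizable \<Sigma> (ct z) \<Longrightarrow> card (seen x0) \<le> card (seen z)"
    by blast
  define T where "T = ct x0"
  define S where "S = seen x0"
  define N where "N = {y \<in> W. ct y = T \<and> seen y = S}"
  \<comment> \<open>Minimal cardinality becomes minimality under inclusion, because \<open>S\<close>
    is finite.\<close>
  have seen_eq: "seen z = S" if "z \<in> W" "\<not> realizable \<Sigma> (ct z)" "seen z \<subseteq> S" for z
    using min[OF that(1,2)] that(3) finite_seen unfolding S_def by (simp add: card_seteq)
  obtain x1 where x1: "(x0, x1) \<in> R" "ct x1 = T"
    and leave: "\<And>z w. (x1, z) \<in> R \<Longrightarrow> (z, w) \<in> R \<Longrightarrow> ct w = T \<Longrightarrow> ct z = T"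
    using definable_grz[OF definable_ct, of x0 T] x0(1) T_def by blast
  have "x1 \<in> W" using frame_props(2)[OF x1(1)] by blast
  have "seen x1 = S"
    using seen_eq[of x1] \<open>x1 \<in> W\<close> x1 x0(2) seen_R[OF x1(1)] unfolding T_def S_def by simp
  have "T \<in> S"
    unfolding S_def mem_seen T_def using frame_props(4)[OF x0(1)] by blast
  interpret region W R E V \<phi> N T S
  proof
    show "N \<subseteq> W" "\<And>y. y \<in> N \<Longrightarrow> ct y = T" "\<And>y. y \<in> N \<Longrightarrow> seen y = S"
      by (auto simp: N_def)
    show "N \<noteq> {}"
      using \<open>x1 \<in> W\<close> x1(2) \<open>seen x1 = S\<close> by (auto simp: N_def)
    show "z \<in> N" if "y \<in> N" "(y, z) \<in> E" for y z
      using that(1) ct_E[OF that(2)] seen_E[OF that(2)] frame_props(3)[OF that(2)] by (simp add: N_def)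
    \<comment> \<open>Class type \<open>T\<close> is not realizable, so minimality applies to
      \<open>z\<close> and prevents its set of seen class types from shrinking.\<close>
    show "z \<in> N" if "y \<in> N" "(y, z) \<in> R" "ct z = T" for y z
      using that seen_eq[of z] seen_R[OF that(2)] frame_props(2)[OF that(2)] x0(2) by (simp add: N_def T_def)
    show "realizable \<Sigma> U" if "U \<in> S" "U \<noteq> T" for U
    proof (rule ccontr)
      assume "\<not> realizable \<Sigma> U"
      \<comment> \<open>\<open>leave\<close> is known only at \<open>x1\<close>, but
        \<open>U\<close> is visible from there because \<open>seen x1 = S\<close>. If
        \<open>U\<close> is not realizable, \<open>z\<close> sees all of \<open>S\<close> by
        minimality, so \<open>T\<close> returns after having been left.\<close>
      obtain z where z: "(x1, z) \<in> R" "ct z = U"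
        using \<open>U \<in> S\<close> mem_seen unfolding \<open>seen x1 = S\<close>[symmetric] by blast
      have "seen z = S"
        using seen_eq[of z] frame_props(2)[OF z(1)] z(2) \<open>\<not> realizable \<Sigma> U\<close> seen_R[OF z(1)] \<open>seen x1 = S\<close>
        by simp
      then obtain w where "(z, w) \<in> R" "ct w = T"
        using \<open>T \<in> S\<close> mem_seen by blast
      then show False using leave[OF z(1)] z(2) \<open>U \<noteq> T\<close> by blast
    qed
  qed
  show False using realizable_T x0(2) by (simp add: T_def)
qed

section \<open>Truth lemma and the finite model property\<close>

definition canonical_val :: "nat \<Rightarrow> fm set set" where
  "canonical_val n = {\<Gamma>. world \<Gamma> \<and> Var n \<in> \<Gamma>}"

lemma truth_lemma:
  assumes "world \<Gamma>"
  shows "sat R.rel E.rel canonical_val \<Gamma> a \<longleftrightarrow> a \<in> \<Gamma>"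
  using assms
proof (induction a arbitrary: \<Gamma>)
  case (Dia a)
  have "a \<in> \<Delta> \<Longrightarrow> Dia a \<in> \<Gamma>" if "(\<Gamma>, \<Delta>) \<in> R.rel" for \<Delta>
    using that by (auto simp: R.rel_def)
  then show ?case
    using Dia R.rel_witness[of \<Gamma> a] R.rel_world unfolding sat.simps by blast
next
  case (Some_E a)
  have "a \<in> \<Delta> \<Longrightarrow> Some_E a \<in> \<Gamma>" if "(\<Gamma>, \<Delta>) \<in> E.rel" for \<Delta>
    using that by (auto simp: E.rel_def)
  then show ?case
    using Some_E E.rel_witness[of \<Gamma> a] E.rel_world unfolding sat.simps by blast
qed (auto simp: canonical_val_def world_simps)

lemma canonical_grz_model: "\<not> MGrz \<phi> \<Longrightarrow> grz_model {\<Gamma>. world \<Gamma>} R.rel E.rel canonical_val"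
proof
  assume "\<not> MGrz \<phi>"
  show "MS4_frame {\<Gamma>. world \<Gamma>} R.rel E.rel"
  proof (rule MS4_frameI)
    \<comment> \<open>An inconsistent logic would prove \<open>\<phi>\<close>; hence the empty set
      is consistent and extends to a world.\<close>
    have "\<not> derives {} \<phi>"
      using \<open>\<not> MGrz \<phi>\<close> by (simp add: derives_def)
    then have "\<not> derives {} Bot"
      using derives_cons[of "[Bot]" "{}" \<phi>] by auto
    then show "{\<Gamma>. world \<Gamma>} \<noteq> {}"
      using world_extension by blast
    show "R.rel \<subseteq> {\<Gamma>. world \<Gamma>} \<times> {\<Gamma>. world \<Gamma>}" "E.rel \<subseteq> {\<Gamma>. world \<Gamma>} \<times> {\<Gamma>. world \<Gamma>}"
      using R.rel_world E.rel_world by auto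
    show "(\<Gamma>, \<Gamma>) \<in> R.rel" "(\<Gamma>, \<Gamma>) \<in> E.rel" if "\<Gamma> \<in> {\<Gamma>. world \<Gamma>}" for \<Gamma>
      using that R.rel_refl E.rel_refl by simp_all
  qed (fact E_sym R.rel_trans E.rel_trans E_R_commute)+
next
  fix \<Gamma> a
  assume "\<Gamma> \<in> {\<Gamma>. world \<Gamma>}" and a: "sat R.rel E.rel canonical_val \<Gamma> a"
  let ?sat = "sat R.rel E.rel canonical_val"
  let ?p = "Neg a"
  have "MGrz (Imp (Box (Imp (Box (Imp ?p (Box ?p))) ?p)) ?p)"
    using MGrz_subst[OF MGrz_Grz[OF Grz_grz], of "\<lambda>_. ?p"] by simp
  then have "?sat \<Gamma> (Imp (Box (Imp (Box (Imp ?p (Box ?p))) ?p)) ?p)"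
    using \<open>\<Gamma> \<in> {\<Gamma>. world \<Gamma>}\<close> truth_lemma world_simps(1) by blast
  then show "\<exists>y. (\<Gamma>, y) \<in> R.rel \<and> ?sat y a \<and>
      (\<forall>z w. (y, z) \<in> R.rel \<longrightarrow> (z, w) \<in> R.rel \<longrightarrow> ?sat w a \<longrightarrow> ?sat z a)"
    using a by auto
qed

theorem theorem7p17:
  fixes \<phi> :: fm
  assumes "\<not> MGrz \<phi>"
  shows "\<exists>(X :: nat set) R E. finite X \<and> MGrz_frame X R E \<and> \<not> valid_in X R E \<phi>"
proof -
  interpret grz_model "{\<Gamma>. world \<Gamma>}" R.rel E.rel canonical_val \<phi>
    using assms by (rule canonical_grz_model)
  have "\<not> derives {Neg \<phi>} Bot"
  proof
    assume "derives {Neg \<phi>} Bot"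
    then have "derives {} (Imp (Neg \<phi>) Bot)"
      by (rule derives_insert)
    then have "derives {} \<phi>"
      using derives_cons[of "[Imp (Neg \<phi>) Bot]" "{}" \<phi>] by auto
    then show False using assms by (simp add: derives_def)
  qed
  then obtain \<Gamma> where \<Gamma>: "world \<Gamma>" "\<phi> \<notin> \<Gamma>"
    using world_extension[of "{Neg \<phi>}"] world_simps(2) by blast
  then obtain X :: "nat set" and R E V p where real: "realizes \<Sigma> X R E V p (ct \<Gamma>)"
    using all_realizable[of \<Gamma>] unfolding realizable_def by blast
  then have fr: "finite X" "MS4_frame X R E" "antisym R" "\<forall>n. V n \<subseteq> X"
    and ct: "class_type \<Sigma> R E V p = ct \<Gamma>"
    by (auto simp: realizes_def)
  \<comment> \<open>The finite model realizes the whole class type of \<open>\<Gamma>\<close>, so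
    some point in the \<open>E\<close>-class of \<open>p\<close> has the type of
    \<open>\<Gamma>\<close> itself and refutes \<open>\<phi>\<close>.\<close>
  have "tp \<Gamma> \<in> class_type \<Sigma> R E V p"
    unfolding ct mem_ct using frame_props(5) \<Gamma>(1) by blast
  then obtain q where q: "(p, q) \<in> E" "point_type \<Sigma> R E V q = tp \<Gamma>"
    by (auto simp: class_type_def)
  have "\<phi> \<notin> tp \<Gamma>"
    using \<Gamma> truth_lemma by (simp add: point_type_def)
  then have "\<not> sat R E V q \<phi>"
    unfolding q(2)[symmetric] by (simp add: point_type_def subformulas_refl)
  moreover have "q \<in> X"
    using MS4_frameD(3)[OF fr(2) q(1)] by blast
  ultimately have "\<not> valid_in X R E \<phi>"
    using fr(4) unfolding valid_in_def by blast
  then show ?thesis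
    using MGrz_sound[OF fr(1-3)] fr(1) by blast
qed

end
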